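(* Let $\mathcal{A}$ be a finite or countable set, $\Omega=\mathcal{A}^{\mathbb{N}}$, $T:\Omega\to\Omega$ the left shift, $P$ a $T$-invariant $\psi$-mixing probability measure on $\Omega$, and $\upsilon>0$ a constant such that $P(A)\le e^{-\upsilon n}$ for all $n\ge1$ and all $A\in\mathcal{C}_n$. Let $\ell\ge1$ and let $q_1,\dots,q_\ell:\mathbb{N}\to\mathbb{N}$ be strictly increasing functions satisfying $0\le q_1(n)<\dots<q_\ell(n)$ for all $n\ge0$ and $q(n)=\min_{k\ge n}\min_{1\le i\le\ell-1}(q_{i+1}(k)-q_i(k))\to\infty$ as $n\to\infty$. There exists a constant $C=C(\ell,\psi(1))\ge1$ (depending only on $\ell$ and $\psi(1)$) such that for every $(\omega,\eta)\in\Omega_P\times\Omega_P$ and $n,m\ge1$ with $\psi(m)<(3/2)^{1/(\ell+1)}-1$, $$d_{TV}\Bigl(\mathcal{L}(\Sigma^{\omega,\eta}_{n,m}),\mathrm{Geo}\Bigl(\frac{P(A_m^\eta)^\ell}{P(A_m^\eta)^\ell+P(A_n^\omega)^\ell}\Bigr)\Bigr)$$ $$\le C\left(e^{-\frac12\upsilon\kappa^{\omega,\eta}_{n,m}}\gamma(n\vee m)+\left(1+\left(\frac{P(A_n^\omega)}{P(A_m^\eta)}\right)^\ell\right)\left((n\vee m)e^{-\frac12\upsilon\kappa^{\omega,\eta}_{n,m}}+\psi(m)^{1/2}\right)\right).$$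
   Context: $\mathbb{N}=\{0,1,2,\dots\}$. $\Omega=\mathcal{A}^{\mathbb{N}}$ carries the $\sigma$-algebra $\mathcal{F}$ generated by cylinder sets. For a word $a=(a_0,\dots,a_{n-1})\in\mathcal{A}^n$, $[a]=\{\omega\in\Omega:\omega_i=a_i,\ 0\le i\le n-1\}$; $\mathcal{C}_n=\{[w]:w\in\mathcal{A}^n\}$. $\Omega_P=\{\omega\in\Omega: P[\omega_0,\dots,\omega_n]>0\text{ for all }n\ge0\}$. $\psi$-mixing: for $m\le n$ let $\mathcal{F}_{mn}$ be the $\sigma$-algebra generated by the coordinates $\omega_m,\dots,\omega_n$ (and $\mathcal{F}_{m,\infty}$ by $\omega_m,\omega_{m+1},\dots$). For $\sigma$-algebras $\mathcal{G},\mathcal{H}$ put $\psi(\mathcal{G},\mathcal{H})=\sup\{|\frac{P(\Gamma\cap\Delta)}{P(\Gamma)P(\Delta)}-1|:\Gamma\in\mathcal{G},\Delta\in\mathcal{H},P(\Gamma)P(\Delta)\ne0\}$ and $\psi(n)=\sup_{m\ge0}\psi(\mathcal{F}_{0,m},\mathcal{F}_{m+n,\infty})$. $P$ is $\psi$-mixing if $\psi(1)<\infty$ and $\psi(n)\to0$ as $n\to\infty$. $n\vee m=\max\{n,m\}$, $n\wedge m=\min\{n,m\}$. For $A\in\mathcal{C}_n$, $B\in\mathcal{C}_m$: $$\pi(A)=\min\{1\le k\le n: A\cap T^{-k}A\ne\emptyset\},\qquad \pi(A,B)=\min\{0\le k\le n\wedge m: A\cap T^{-k}B\ne\emptyset\text{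 or }B\cap T^{-k}A\ne\emptyset\}.$$ $\gamma(n)=\min\{k\ge0:q(k)\ge2n\}$ (if $\ell=1$ the minimum over the empty set defining $q$ is $+\infty$, so $\gamma\equiv 0$). For $\eta\in\Omega$, $n\ge1$: $A_n^\eta=[\eta_0\dots\eta_{n-1}]\in\mathcal{C}_n$ and $\tau_n^\eta(\omega)=\inf\{k\ge1: T^{q_i(k)}\omega\in A_n^\eta\text{ for all }1\le i\le\ell\}$. For $\omega,\eta\in\Omega$ and $n,m\ge1$, $$\Sigma^{\omega,\eta}_{n,m}=\sum_{k=0}^{\tau_m^\eta-1}\prod_{i=1}^\ell\mathbb{I}_{A_n^\omega}\circ T^{q_i(k)},\qquad \kappa^{\omega,\eta}_{n,m}=\min\{\pi(A_n^\omega,A_m^\eta),\pi(A_n^\omega),\pi(A_m^\eta)\}.$$ Here $\Sigma^{\omega,\eta}_{n,m}$ is a random variable on $(\Omega,\mathcal{F},P)$, and $\mathbb{I}_A$ is the indicator of $A$. $\mathcal{L}(Y)$ is the distribution of $Y$; $d_{TV}(\mu,\nu)=\sup_G|\mu(G)-\nu(G)|$ over measurable sets $G$; for $\rho\in(0,1)$, $\mathrm{Geo}(\rho)\{k\}=\rho(1-\rho)^k$, $k\in\mathbb{N}$. *)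

theory Defs
  imports "HOL-Probability.Probability"
begin

definition shift :: "(nat \<Rightarrow> 'a) \<Rightarrow> nat \<Rightarrow> 'a" where
  "shift \<omega> = (\<lambda>n. \<omega> (Suc n))"

definition Omega :: "'a set \<Rightarrow> (nat \<Rightarrow> 'a) set" where
  "Omega A = (UNIV \<rightarrow>\<^sub>E A)"

text \<open>The space of \<open>seq_space A\<close> is \<open>Omega A\<close>; for countable \<open>A\<close> its \<open>\<sigma>\<close>-algebra is the one
  generated by the cylinder sets.\<close>

definition seq_space :: "'a set \<Rightarrow> (nat \<Rightarrow> 'a) measure" where
  "seq_space A = (\<Pi>\<^sub>M i\<in>UNIV. count_space A)"

definition cyl :: "'a set \<Rightarrow> 'a list \<Rightarrow> (nat \<Rightarrow> 'a) set" where
  "cyl A w = {\<omega> \<in> Omega A. \<forall>i<length w. \<omega> i = w ! i}"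

definition cylinders :: "'a set \<Rightarrow> nat \<Rightarrow> (nat \<Rightarrow> 'a) set set" where
  "cylinders A n = {cyl A w | w. set w \<subseteq> A \<and> length w = n}"

definition initial_cyl :: "'a set \<Rightarrow> (nat \<Rightarrow> 'a) \<Rightarrow> nat \<Rightarrow> (nat \<Rightarrow> 'a) set" where
  "initial_cyl A \<eta> n = cyl A (map \<eta> [0..<n])"

definition Omega_P :: "'a set \<Rightarrow> (nat \<Rightarrow> 'a) measure \<Rightarrow> (nat \<Rightarrow> 'a) set" where
  "Omega_P A P = {\<omega> \<in> Omega A. \<forall>n. measure P (initial_cyl A \<omega> (Suc n)) > 0}"

definition coord_algebra :: "'a set \<Rightarrow> nat set \<Rightarrow> (nat \<Rightarrow> 'a) set set" where
  "coord_algebra A I = sigma_sets (Omega A) {{\<omega> \<in> Omega A. \<omega> i \<in> B} | i B. i \<in> I \<and> B \<subseteq> A}"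

definition psi_dep :: "'b measure \<Rightarrow> 'b set set \<Rightarrow> 'b set set \<Rightarrow> ennreal" where
  "psi_dep P G H =
     (SUP (\<Gamma>, \<Delta>) \<in> {(\<Gamma>, \<Delta>). \<Gamma> \<in> G \<and> \<Delta> \<in> H \<and> measure P \<Gamma> * measure P \<Delta> \<noteq> 0}.
        ennreal \<bar>measure P (\<Gamma> \<inter> \<Delta>) / (measure P \<Gamma> * measure P \<Delta>) - 1\<bar>)"

definition psi :: "'a set \<Rightarrow> (nat \<Rightarrow> 'a) measure \<Rightarrow> nat \<Rightarrow> ennreal" where
  "psi A P n = (SUP m. psi_dep P (coord_algebra A {0..m}) (coord_algebra A {m + n..}))"

definition psi_mixing :: "'a set \<Rightarrow> (nat \<Rightarrow> 'a) measure \<Rightarrow> bool" where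
  "psi_mixing A P \<longleftrightarrow> psi A P 1 < \<infinity> \<and> psi A P \<longlonglongrightarrow> 0"

text \<open>The lengths \<open>n\<close>, \<open>m\<close> of the cylinders \<open>E\<close>, \<open>F\<close> are passed explicitly. The two minima are over
  nonempty sets, since for cylinders \<open>k = n\<close>, respectively \<open>k = min n m\<close>, always qualifies.\<close>

definition period :: "nat \<Rightarrow> (nat \<Rightarrow> 'a) set \<Rightarrow> nat" where
  "period n E = Min {k. 1 \<le> k \<and> k \<le> n \<and> E \<inter> (shift ^^ k) -` E \<noteq> {}}"

definition cross_period :: "nat \<Rightarrow> nat \<Rightarrow> (nat \<Rightarrow> 'a) set \<Rightarrow> (nat \<Rightarrow> 'a) set \<Rightarrow> nat" where
  "cross_period n m E F =
     Min {k. k \<le> min n m \<and> (E \<inter> (shift ^^ k) -` F \<noteq> {} \<or> F \<inter> (shift ^^ k) -` E \<noteq> {})}"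

definition kappa :: "'a set \<Rightarrow> (nat \<Rightarrow> 'a) \<Rightarrow> (nat \<Rightarrow> 'a) \<Rightarrow> nat \<Rightarrow> nat \<Rightarrow> nat" where
  "kappa A \<omega> \<eta> n m =
     Min {cross_period n m (initial_cyl A \<omega> n) (initial_cyl A \<eta> m),
          period n (initial_cyl A \<omega> n), period m (initial_cyl A \<eta> m)}"

text \<open>The functions \<open>q\<^sub>1, \<dots>, q\<^sub>l\<close> are \<open>q 1, \<dots>, q l\<close>. For \<open>l = 1\<close> the inner infimum is over the empty
  set, so \<open>qgap 1 q n = \<infinity>\<close> and \<open>gap_index 1 q n = 0\<close>.\<close>

definition qgap :: "nat \<Rightarrow> (nat \<Rightarrow> nat \<Rightarrow> nat) \<Rightarrow> nat \<Rightarrow> enat" where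
  "qgap l q n = (INF k\<in>{n..}. INF i\<in>{1..<l}. enat (q (Suc i) k - q i k))"

definition gap_index :: "nat \<Rightarrow> (nat \<Rightarrow> nat \<Rightarrow> nat) \<Rightarrow> nat \<Rightarrow> nat" where
  "gap_index l q n = (LEAST k. enat (2 * n) \<le> qgap l q k)"

definition tau :: "'a set \<Rightarrow> nat \<Rightarrow> (nat \<Rightarrow> nat \<Rightarrow> nat) \<Rightarrow> (nat \<Rightarrow> 'a) \<Rightarrow> nat \<Rightarrow> (nat \<Rightarrow> 'a) \<Rightarrow> enat" where
  "tau A l q \<eta> n x =
     Inf {enat k | k. 1 \<le> k \<and> (\<forall>i\<in>{1..l}. (shift ^^ q i k) x \<in> initial_cyl A \<eta> n)}"

text \<open>On the event \<open>tau = \<infinity>\<close> the sum below is the full series; hence the values in \<open>enat\<close>.\<close>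

definition Sigma_count ::
  "'a set \<Rightarrow> nat \<Rightarrow> (nat \<Rightarrow> nat \<Rightarrow> nat) \<Rightarrow> (nat \<Rightarrow> 'a) \<Rightarrow> (nat \<Rightarrow> 'a) \<Rightarrow> nat \<Rightarrow> nat \<Rightarrow> (nat \<Rightarrow> 'a) \<Rightarrow> enat"
where
  "Sigma_count A l q \<omega> \<eta> n m x =
     (\<Sum>k. if enat k < tau A l q \<eta> m x
           then \<Prod>i\<in>{1..l}. indicator (initial_cyl A \<omega> n) ((shift ^^ q i k) x) else 0)"

definition d_TV :: "'b measure \<Rightarrow> 'b measure \<Rightarrow> real" where
  "d_TV M N = (SUP G\<in>sets M. \<bar>measure M G - measure N G\<bar>)"

text \<open>\<open>geometric_pmf \<rho>\<close> has mass \<open>\<rho> (1 - \<rho>)\<^sup>k\<close> at \<open>k\<close>; it is moved to \<open>enat\<close>, where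
  \<open>Sigma_count\<close> takes its values.\<close>

definition Geo :: "real \<Rightarrow> enat measure" where
  "Geo \<rho> = measure_pmf (map_pmf enat (geometric_pmf \<rho>))"

end

theory Submission
  imports Defs
begin

text \<open>Fix the two words and let a mark (hazard) at time \<open>k\<close> be the event that the word of \<open>\<omega>\<close> (of \<open>\<eta>\<close>) is seen
simultaneously at all positions \<open>q 1 k, \<dots>, q l k\<close>. The quantity of interest is the number of marks before the
first hazard. Marks have probability about \<open>\<alpha> = P(A\<^sub>n\<^sup>\<omega>)\<^sup>l\<close> and hazards about \<open>\<beta> = P(A\<^sub>m\<^sup>\<eta>)\<^sup>l\<close>. If different times
were independent and marks and hazards were disjoint, each mark or hazard would be a hazard with probability
\<open>\<beta> / (\<beta> + \<alpha>)\<close>, and the count would have the geometric law with this parameter.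

The comparison with the dependent situation is a martingale argument (\<open>count_before_hazard_geometric\<close>). For a
set \<open>G\<close> of outcomes, follow the conditional probability of \<open>G\<close> that the geometric law would predict from the current
count, frozen at the first hazard. The average change of this quantity in one step is zero under independence, by
the recursion that defines the geometric law. Under dependence it is a sum of two errors, one from past times
close to the present and one from imperfect mixing with the remaining past. Summing over a time horizon \<open>t\<close> gives
the distance between the two laws, up to the probability that no hazard occurs before \<open>t\<close>; this probability is
of order \<open>1 / (\<beta> * t)\<close>, up to errors of the same kind.

The errors are estimated as follows. A past index is close if one of its positions comes within twice the word
length \<open>N\<close> of one of the present positions; there are at most \<open>4 * N * l\<^sup>2\<close> of these (\<open>near_bound\<close>). Visits at two
different times are improbable because \<open>\<kappa>\<close> forbids short overlaps: the earlier visit shows at least \<open>\<kappa>\<close> letters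
to the left of the later one, which costs a factor \<open>exp (- \<upsilon> * \<kappa>)\<close> (\<open>overlap_visit\<close>). The remaining past lies
outside long gaps around the present positions, and detaching the \<open>l\<close> positions one by one shows that it is
independent of the present up to a relative error of the order of \<open>\<psi>(m)\<close> (\<open>decouple_windows\<close>). Here countability of the
alphabet reduces everything to atoms of finitely many coordinates. For the separation of the \<open>l\<close> positions
from each other the index has to be at least \<open>\<gamma>(n \<or> m)\<close>; smaller indices are counted with the probability of a
single word, which is the first term of the estimate.

Finally the horizon is chosen of order \<open>1 / (\<beta> * (exp (- \<upsilon> * \<kappa> / 2) + \<psi>(m)\<^bsup>1/2\<^esup>))\<close>, which balances the survival
probability against the accumulated errors (\<open>optimal_horizon\<close>).\<close>

section \<open>Counting marks before a hazard\<close>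

lemma geometric_prob_unfold:
  assumes "0 < p" "p \<le> 1"
  shows "measure_pmf.prob (geometric_pmf p) {j. Q j}
    = p * of_bool (Q 0) + (1 - p) * measure_pmf.prob (geometric_pmf p) {j. Q (Suc j)}"
proof -
  let ?g = "geometric_pmf p"
  have "ennreal (measure_pmf.prob ?g {j. Q j}) = emeasure ?g {j. Q j}"
    by (simp add: measure_pmf.emeasure_eq_measure)
  also have "\<dots> = emeasure (bind_pmf (bernoulli_pmf p)
      (\<lambda>b. if b then return_pmf 0 else map_pmf Suc ?g)) {j. Q j}"
    using assms by (subst geometric_bind_pmf_unfold) auto
  also have "\<dots> = of_bool (Q 0) * ennreal p + emeasure ?g {j. Q (Suc j)} * ennreal (1 - p)"
    using assms by (simp add: vimage_def)
  also have "\<dots> = ennreal (p * of_bool (Q 0) + (1 - p) * measure_pmf.prob ?g {j. Q (Suc j)})"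
    using assms by (simp add: measure_pmf.emeasure_eq_measure ennreal_mult' ennreal_plus mult.commute)
  finally show ?thesis
    using assms by (subst (asm) ennreal_inj) auto
qed

context prob_space
begin

text \<open>The atoms of the finite algebra generated by the events of two sequences with indices in \<open>J\<close>: \<open>U\<close> and \<open>W\<close>
list which of them occur. Independence of the past will only ever be tested on such atoms.\<close>

definition profile :: "(nat \<Rightarrow> 'a set) \<Rightarrow> (nat \<Rightarrow> 'a set) \<Rightarrow> nat set \<Rightarrow> nat set \<Rightarrow> nat set \<Rightarrow> 'a set" where
  "profile X Y J U W = {x \<in> space M. {j \<in> J. x \<in> X j} = U \<and> {j \<in> J. x \<in> Y j} = W}"

lemma profile_events:
  assumes "\<And>k. X k \<in> events" "\<And>k. Y k \<in> events" "finite J"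
  shows "profile X Y J U W \<in> events"
proof (cases "U \<subseteq> J \<and> W \<subseteq> J")
  case True
  then have "profile X Y J U W =
      {x \<in> space M. (\<forall>j\<in>J. (x \<in> X j \<longleftrightarrow> j \<in> U)) \<and> (\<forall>j\<in>J. (x \<in> Y j \<longleftrightarrow> j \<in> W))}"
    unfolding profile_def by auto
  also have "\<dots> \<in> events"
    using assms by measurable
  finally show ?thesis .
next
  case False
  then have "profile X Y J U W = {}" unfolding profile_def by auto
  then show ?thesis by simp
qed

lemma profile_expansion:
  fixes F :: "nat set \<Rightarrow> nat set \<Rightarrow> real"
  assumes "finite J" "x \<in> space M"
  shows "F {j \<in> J. x \<in> X j} {j \<in> J. x \<in> Y j}
    = (\<Sum>(U, W)\<in>Pow J \<times> Pow J. F U W * indicator (profile X Y J U W) x)"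
proof -
  let ?c = "({j \<in> J. x \<in> X j}, {j \<in> J. x \<in> Y j})"
  have "(\<Sum>(U, W)\<in>Pow J \<times> Pow J. F U W * indicator (profile X Y J U W) x)
      = (\<Sum>c\<in>Pow J \<times> Pow J. if c = ?c then F (fst c) (snd c) else 0)"
    using assms by (intro sum.cong) (auto simp: profile_def indicator_def)
  also have "\<dots> = F {j \<in> J. x \<in> X j} {j \<in> J. x \<in> Y j}"
    using assms by (subst sum.delta) auto
  finally show ?thesis by simp
qed

lemma profile_borel:
  fixes F :: "nat set \<Rightarrow> nat set \<Rightarrow> real"
  assumes [measurable]: "\<And>k. X k \<in> events" "\<And>k. Y k \<in> events" and "finite J"
  shows "(\<lambda>x. F {j \<in> J. x \<in> X j} {j \<in> J. x \<in> Y j}) \<in> borel_measurable M"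
proof -
  have [measurable]: "profile X Y J U W \<in> events" for U W
    using assms by (rule profile_events)
  have "(\<lambda>x. \<Sum>c\<in>Pow J \<times> Pow J. F (fst c) (snd c) * indicator (profile X Y J (fst c) (snd c)) x) \<in> borel_measurable M"
    by measurable
  then show ?thesis
    by (subst measurable_cong[OF profile_expansion[OF \<open>finite J\<close>]]) (auto simp: case_prod_unfold)
qed

lemma integral_profile:
  fixes F :: "nat set \<Rightarrow> nat set \<Rightarrow> real"
  assumes ev: "\<And>k. X k \<in> events" "\<And>k. Y k \<in> events" and J: "finite J" and H: "H \<in> events"
  shows "(\<integral>x. indicator H x * F {j \<in> J. x \<in> X j} {j \<in> J. x \<in> Y j} \<partial>M)
    = (\<Sum>(U, W)\<in>Pow J \<times> Pow J. F U W * prob (H \<inter> profile X Y J U W))"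
proof -
  have pe: "profile X Y J U W \<in> events" for U W
    using ev J by (rule profile_events)
  have "(\<integral>x. indicator H x * F {j \<in> J. x \<in> X j} {j \<in> J. x \<in> Y j} \<partial>M)
     = (\<integral>x. (\<Sum>(U, W)\<in>Pow J \<times> Pow J. F U W * indicator (H \<inter> profile X Y J U W) x) \<partial>M)"
  proof (rule Bochner_Integration.integral_cong[OF refl])
    fix x assume "x \<in> space M"
    show "indicator H x * F {j \<in> J. x \<in> X j} {j \<in> J. x \<in> Y j}
      = (\<Sum>(U, W)\<in>Pow J \<times> Pow J. F U W * indicator (H \<inter> profile X Y J U W) x)"
      unfolding profile_expansion[OF J \<open>x \<in> space M\<close>]
      by (auto simp: sum_distrib_left indicator_inter_arith case_prod_unfold intro!: sum.cong)
  qed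
  also have "\<dots> = (\<Sum>(U, W)\<in>Pow J \<times> Pow J. F U W * prob (H \<inter> profile X Y J U W))"
    unfolding case_prod_unfold using pe H
    by (subst Bochner_Integration.integral_sum) (auto intro!: integrable_mult_right sum.cong simp: emeasure_eq_measure)
  finally show ?thesis .
qed

text \<open>A function of the past is a finite combination of indicators of atoms, so a relative error \<open>\<delta>\<close> on each atom
turns into an error proportional to the expectation of the absolute value. This proportionality, rather
than a bound by the supremum, is what allows the survival estimate in \<open>count_before_hazard_geometric\<close>.\<close>

lemma profile_decoupling:
  fixes F :: "nat set \<Rightarrow> nat set \<Rightarrow> real"
  assumes ev: "\<And>k. X k \<in> events" "\<And>k. Y k \<in> events" and J: "finite J" and H: "H \<in> events"
    and dec: "\<And>U W. \<bar>prob (H \<inter> profile X Y J U W) - \<alpha> * prob (profile X Y J U W)\<bar>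
        \<le> \<delta> * prob (profile X Y J U W)"
  shows "\<bar>(\<integral>x. indicator H x * F {j \<in> J. x \<in> X j} {j \<in> J. x \<in> Y j} \<partial>M)
      - \<alpha> * (\<integral>x. F {j \<in> J. x \<in> X j} {j \<in> J. x \<in> Y j} \<partial>M)\<bar>
    \<le> \<delta> * (\<integral>x. \<bar>F {j \<in> J. x \<in> X j} {j \<in> J. x \<in> Y j}\<bar> \<partial>M)"
proof -
  let ?p = "\<lambda>U W. profile X Y J U W"
  have full: "(\<integral>x. F' {j \<in> J. x \<in> X j} {j \<in> J. x \<in> Y j} \<partial>M)
      = (\<Sum>(U, W)\<in>Pow J \<times> Pow J. F' U W * prob (?p U W))" for F' :: "nat set \<Rightarrow> nat set \<Rightarrow> real"
  proof -
    have "(\<integral>x. F' {j \<in> J. x \<in> X j} {j \<in> J. x \<in> Y j} \<partial>M)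
      = (\<integral>x. indicator (space M) x * F' {j \<in> J. x \<in> X j} {j \<in> J. x \<in> Y j} \<partial>M)"
      by (rule Bochner_Integration.integral_cong) auto
    moreover have "space M \<inter> ?p U W = ?p U W" for U W
      by (auto simp: profile_def)
    ultimately show ?thesis
      using integral_profile[OF ev J sets.top, of F'] by simp
  qed
  have "(\<integral>x. indicator H x * F {j \<in> J. x \<in> X j} {j \<in> J. x \<in> Y j} \<partial>M)
      - \<alpha> * (\<integral>x. F {j \<in> J. x \<in> X j} {j \<in> J. x \<in> Y j} \<partial>M)
    = (\<Sum>(U, W)\<in>Pow J \<times> Pow J. F U W * (prob (H \<inter> ?p U W) - \<alpha> * prob (?p U W)))"
    unfolding full[of F] integral_profile[OF ev J H, of F]
    by (simp add: sum_distrib_left sum_subtractf case_prod_unfold algebra_simps)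
  also have "\<bar>\<dots>\<bar> \<le> (\<Sum>c\<in>Pow J \<times> Pow J. \<bar>F (fst c) (snd c)\<bar> * (\<delta> * prob (?p (fst c) (snd c))))"
    unfolding case_prod_unfold
    by (rule order_trans[OF sum_abs], rule sum_mono) (auto simp: abs_mult intro!: mult_left_mono dec)
  also have "\<dots> = \<delta> * (\<integral>x. \<bar>F {j \<in> J. x \<in> X j} {j \<in> J. x \<in> Y j}\<bar> \<partial>M)"
    unfolding full[of "\<lambda>U W. \<bar>F U W\<bar>"] by (simp add: sum_distrib_left case_prod_unfold algebra_simps)
  finally show ?thesis .
qed

text \<open>Let \<open>\<phi> s\<close> be the probability that \<open>s\<close> plus a geometric variable lies in \<open>G\<close>. Follow \<open>\<phi>\<close> at the current number of
marks (occurrences of \<open>X\<close>) as long as no hazard (occurrence of \<open>Y\<close>) has happened, and freeze the outcome at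
the first hazard. This process \<open>V\<close> starts at the geometric probability of \<open>G\<close>, and after \<open>g + t\<close> steps it equals
the indicator of \<open>Sig \<in> G\<close> except on survival up to that time. A mark changes it by \<open>D1 s = \<phi> (s + 1) - \<phi> s\<close>
and a hazard by \<open>D2 s = 1\<^sub>G s - \<phi> s\<close>; the recursion of the geometric law says exactly
\<open>\<alpha> * D1 s + \<beta> * D2 s = 0\<close>. Hence \<open>V\<close> would be a martingale if step \<open>k\<close> were independent of its past.

The indices \<open>j < k\<close> in \<open>B k\<close> are meant to be those on which step \<open>k\<close> depends strongly. Dropping them from the past costs
the overlap probabilities (\<open>\<theta>\<close>), and the remaining past decouples from step \<open>k\<close> up to the relative error \<open>\<delta>\<close>.

Survival is improbable because the events of a first hazard at time \<open>k\<close> are disjoint, so their probabilities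
add up to at most 1, whereas by the same decoupling each is at least about \<open>\<beta> / 2\<close> times the probability of
surviving.\<close>

lemma count_before_hazard_geometric:
  fixes X Y :: "nat \<Rightarrow> 'a set" and B :: "nat \<Rightarrow> nat set" and Sig :: "'a \<Rightarrow> enat"
    and \<alpha> \<beta> \<delta> \<theta> :: real and g t :: nat
  assumes ev: "\<And>k. X k \<in> events" "\<And>k. Y k \<in> events"
    and disj: "\<And>k. X k \<inter> Y k = {}"
    and Sig: "Sig \<in> M \<rightarrow>\<^sub>M count_space UNIV"
    and stop: "\<And>x k. x \<in> space M \<Longrightarrow> x \<in> Y k \<Longrightarrow> (\<And>j. j < k \<Longrightarrow> x \<notin> Y j) \<Longrightarrow>
        Sig x = enat (card {j \<in> {..<k}. x \<in> X j})"
    and pos: "0 < \<alpha>" "0 < \<beta>" "0 \<le> \<delta>" "\<delta> \<le> 1 / 2" "0 \<le> \<theta>" "0 < t"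
    and decX: "\<And>k U W. g \<le> k \<Longrightarrow>
        \<bar>prob (X k \<inter> profile X Y ({..<k} - B k) U W) - \<alpha> * prob (profile X Y ({..<k} - B k) U W)\<bar>
        \<le> \<delta> * \<alpha> * prob (profile X Y ({..<k} - B k) U W)"
    and decY: "\<And>k U W. g \<le> k \<Longrightarrow>
        \<bar>prob (Y k \<inter> profile X Y ({..<k} - B k) U W) - \<beta> * prob (profile X Y ({..<k} - B k) U W)\<bar>
        \<le> \<delta> * \<beta> * prob (profile X Y ({..<k} - B k) U W)"
    and ovX: "\<And>k. g \<le> k \<Longrightarrow> prob (X k \<inter> (\<Union>j\<in>{..<k} \<inter> B k. X j \<union> Y j)) \<le> \<theta> * \<alpha>"
    and ovY: "\<And>k. g \<le> k \<Longrightarrow> prob (Y k \<inter> (\<Union>j\<in>{..<k} \<inter> B k. X j \<union> Y j)) \<le> \<theta> * \<beta>"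
  shows "\<bar>prob (Sig -` G \<inter> space M) - measure_pmf.prob (geometric_pmf (\<beta> / (\<beta> + \<alpha>))) (enat -` G)\<bar>
    \<le> 2 / (\<beta> * t) + 2 * \<theta> + (\<Sum>k<g. prob (X k) + prob (Y k)) + t * (\<alpha> + \<beta>) * (2 * \<theta> + \<delta>)"
proof -
  define \<rho> where "\<rho> = \<beta> / (\<beta> + \<alpha>)"
  have \<rho>: "0 < \<rho>" "\<rho> \<le> 1" using pos by (auto simp: \<rho>_def)
  define \<phi> where "\<phi> s = measure_pmf.prob (geometric_pmf \<rho>) {j. enat (s + j) \<in> G}" for s
  \<comment> \<open>The effects of a mark and of a hazard on the tracked quantity.\<close>
  define D1 where "D1 s = \<phi> (Suc s) - \<phi> s" for s
  define D2 where "D2 s = of_bool (enat s \<in> G) - \<phi> s" for s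
  have \<phi>01: "0 \<le> \<phi> s" "\<phi> s \<le> 1" for s by (auto simp: \<phi>_def)
  have D1_le: "\<bar>D1 s\<bar> \<le> 1" and D2_le: "\<bar>D2 s\<bar> \<le> 1" for s
    using \<phi>01[of s] \<phi>01[of "Suc s"] by (auto simp: D1_def D2_def)
  have balance: "\<alpha> * D1 s + \<beta> * D2 s = 0" for s
  proof -
    have "\<phi> s = \<rho> * of_bool (enat s \<in> G) + (1 - \<rho>) * \<phi> (Suc s)"
      unfolding \<phi>_def using geometric_prob_unfold[OF \<rho>, of "\<lambda>j. enat (s + j) \<in> G"] by simp
    then have "(\<beta> + \<alpha>) * \<phi> s = (\<beta> + \<alpha>) * (\<rho> * of_bool (enat s \<in> G) + (1 - \<rho>) * \<phi> (Suc s))"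
      by simp
    also have "\<dots> = ((\<beta> + \<alpha>) * \<rho>) * of_bool (enat s \<in> G) + ((\<beta> + \<alpha>) - (\<beta> + \<alpha>) * \<rho>) * \<phi> (Suc s)"
      by (simp add: algebra_simps)
    also have "(\<beta> + \<alpha>) * \<rho> = \<beta>" using pos by (simp add: \<rho>_def)
    finally show ?thesis by (simp add: D1_def D2_def algebra_simps)
  qed
  define F where "F D U W = (if W = {} then D (card U) else 0)" for D :: "nat \<Rightarrow> real" and U W :: "nat set"
  define f where "f D J x = F D {j \<in> J. x \<in> X j} {j \<in> J. x \<in> Y j}" for D J x
  have f_eq: "f D J x = (if \<forall>j\<in>J. x \<notin> Y j then D (card {j \<in> J. x \<in> X j}) else 0)" for D J x
    by (auto simp: f_def F_def)
  have f_le: "\<bar>f D J x\<bar> \<le> 1" if "\<And>s. \<bar>D s\<bar> \<le> 1" for D J x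
    using that by (simp add: f_eq)
  have f_meas [measurable]: "f D J \<in> borel_measurable M" if "finite J" for D J
    unfolding f_def[abs_def] by (rule profile_borel[OF ev that])
  note ev[measurable]
  have Hf_int: "integrable M (\<lambda>x. indicator H x * f D J x)"
    if "\<And>s. \<bar>D s\<bar> \<le> 1" "finite J" "H \<in> events" for D J H
    using that f_le[of D, OF that(1)]
    by (intro integrable_const_bound[where B = 1]) (auto simp: abs_mult indicator_def)
  have f_int: "integrable M (f D J)" if "\<And>s. \<bar>D s\<bar> \<le> 1" "finite J" for D J
    using that f_le[of D, OF that(1)] by (intro integrable_const_bound[where B = 1]) auto

  define S where "S k x = card {j \<in> {..<k}. x \<in> X j}" for k x
  define V where "V k x = (if \<forall>j<k. x \<notin> Y j then \<phi> (S k x) else of_bool (Sig x \<in> G))" for k x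
  have V01: "0 \<le> V k x" "V k x \<le> 1" for k x
    using \<phi>01 by (auto simp: V_def)
  define A where "A k = {x \<in> space M. \<forall>j<k. x \<notin> Y j}" for k
  have A_ev [measurable]: "A k \<in> events" for k
    unfolding A_def by measurable
  have SigG [measurable]: "Sig -` G \<inter> space M \<in> events"
    using Sig by (rule measurable_sets) auto
  have V_alt: "V k x = f \<phi> {..<k} x + indicator (space M - A k) x * indicator (Sig -` G \<inter> space M) x"
    if "x \<in> space M" for k x
    using that by (auto simp: V_def f_eq A_def S_def)
  have V_meas [measurable]: "V k \<in> borel_measurable M" for k
    by (subst measurable_cong[OF V_alt]) measurable
  have V_int: "integrable M (V k)" for k
    using V01 by (intro integrable_const_bound[where B = 1]) auto
  have V_step: "V (Suc k) x - V k x = indicator (X k) x * f D1 {..<k} x + indicator (Y k) x * f D2 {..<k} x"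
    if x: "x \<in> space M" for k x
  proof (cases "\<forall>j<k. x \<notin> Y j")
    case False
    then have "\<not> (\<forall>j<Suc k. x \<notin> Y j)" by (meson less_SucI)
    with False show ?thesis by (auto simp: V_def f_eq)
  next
    case True
    have S_Suc: "S (Suc k) x = (if x \<in> X k then Suc (S k x) else S k x)"
    proof -
      have "{j \<in> {..<Suc k}. x \<in> X j} = (if x \<in> X k then insert k {j \<in> {..<k}. x \<in> X j} else {j \<in> {..<k}. x \<in> X j})"
        by (auto simp: less_Suc_eq)
      then show ?thesis by (simp add: S_def)
    qed
    have S_eq: "card {j. j < k \<and> x \<in> X j} = S k x" by (simp add: S_def)
    show ?thesis
    proof (cases "x \<in> Y k")
      case True': True
      then have "x \<notin> X k" using disj by blast
      moreover have "Sig x = enat (S k x)"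
        unfolding S_def using True by (intro stop[OF x True']) auto
      moreover have "\<not> (\<forall>j<Suc k. x \<notin> Y j)" using True' by blast
      ultimately show ?thesis
        using True True' by (auto simp: V_def f_eq D2_def S_eq)
    next
      case False
      then have "\<forall>j<Suc k. x \<notin> Y j" using True by (auto simp: less_Suc_eq)
      then show ?thesis
        using True False S_Suc by (auto simp: V_def f_eq D1_def S_eq)
    qed
  qed
  define d where "d k = (\<integral>x. V (Suc k) x \<partial>M) - (\<integral>x. V k x \<partial>M)" for k
  have d_eq: "d k = (\<integral>x. indicator (X k) x * f D1 {..<k} x \<partial>M) + (\<integral>x. indicator (Y k) x * f D2 {..<k} x \<partial>M)" for k
  proof -
    have "d k = (\<integral>x. V (Suc k) x - V k x \<partial>M)"
      unfolding d_def using V_int by simp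
    also have "\<dots> = (\<integral>x. indicator (X k) x * f D1 {..<k} x + indicator (Y k) x * f D2 {..<k} x \<partial>M)"
      by (intro Bochner_Integration.integral_cong V_step) auto
    also have "\<dots> = (\<integral>x. indicator (X k) x * f D1 {..<k} x \<partial>M) + (\<integral>x. indicator (Y k) x * f D2 {..<k} x \<partial>M)"
      using Hf_int[of D1, OF D1_le _ ev(1)] Hf_int[of D2, OF D2_le _ ev(2)] by simp
    finally show ?thesis .
  qed
  have d_trivial: "\<bar>d k\<bar> \<le> prob (X k) + prob (Y k)" for k
  proof -
    have *: "\<bar>\<integral>x. indicator H x * f D J x \<partial>M\<bar> \<le> prob H"
      if "\<And>s. \<bar>D s\<bar> \<le> 1" "finite J" "H \<in> events" for D J H
    proof -
      have "\<bar>\<integral>x. indicator H x * f D J x \<partial>M\<bar> \<le> (\<integral>x. indicator H x \<partial>M)"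
      proof (intro order_trans[OF integral_abs_bound] integral_mono)
        show "\<bar>indicator H x * f D J x\<bar> \<le> (indicator H x :: real)" for x
          using f_le[of D J x, OF that(1)] by (simp add: indicator_def)
      qed (use Hf_int[of D, OF that] that in \<open>auto simp: emeasure_eq_measure\<close>)
      then show ?thesis using that by simp
    qed
    show ?thesis unfolding d_eq
      using *[of D1 "{..<k}" "X k", OF D1_le finite_lessThan ev(1)] *[of D2 "{..<k}" "Y k", OF D2_le finite_lessThan ev(2)] by linarith
  qed

  have d_small: "\<bar>d k\<bar> \<le> (\<alpha> + \<beta>) * (2 * \<theta> + \<delta>)" if k: "g \<le> k" for k
  proof -
    let ?J = "{..<k} - B k" and ?R = "\<Union>j\<in>{..<k} \<inter> B k. X j \<union> Y j"
    have R_ev: "?R \<in> events" using ev by auto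
    \<comment> \<open>Outside the event \<open>?R\<close> the full past and the past without \<open>B k\<close> coincide.\<close>
    have remove: "\<bar>(\<integral>x. indicator H x * f D {..<k} x \<partial>M) - (\<integral>x. indicator H x * f D ?J x \<partial>M)\<bar> \<le> 2 * prob (H \<inter> ?R)"
      if D: "\<And>s. \<bar>D s\<bar> \<le> 1" and H: "H \<in> events" for D H
    proof -
      have "(\<integral>x. indicator H x * f D {..<k} x \<partial>M) - (\<integral>x. indicator H x * f D ?J x \<partial>M)
          = (\<integral>x. indicator H x * f D {..<k} x - indicator H x * f D ?J x \<partial>M)"
        using Hf_int[of D, OF D _ H] by simp
      also have "\<bar>\<dots>\<bar> \<le> (\<integral>x. 2 * indicator (H \<inter> ?R) x \<partial>M)"
      proof (intro order_trans[OF integral_abs_bound] integral_mono)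
        fix x assume "x \<in> space M"
        show "\<bar>indicator H x * f D {..<k} x - indicator H x * f D ?J x\<bar> \<le> (2 * indicator (H \<inter> ?R) x :: real)"
        proof (cases "x \<in> ?R")
          case False
          then have "{j \<in> {..<k}. x \<in> X j} = {j \<in> ?J. x \<in> X j}"
            and "{j \<in> {..<k}. x \<in> Y j} = {j \<in> ?J. x \<in> Y j}" by auto
          then show ?thesis by (simp add: f_def)
        next
          case True
          have "\<bar>f D {..<k} x - f D ?J x\<bar> \<le> 2"
            using f_le[of D "{..<k}" x, OF D] f_le[of D ?J x, OF D] by linarith
          with True show ?thesis by (simp add: indicator_def)
        qed
      qed (use Hf_int[of D, OF D _ H] R_ev H in \<open>auto simp: emeasure_eq_measure\<close>)
      also have "\<dots> = 2 * prob (H \<inter> ?R)" using R_ev H by simp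
      finally show ?thesis .
    qed
    have decouple: "\<bar>(\<integral>x. indicator H x * f D ?J x \<partial>M) - c * (\<integral>x. f D ?J x \<partial>M)\<bar> \<le> \<delta> * c"
      if D: "\<And>s. \<bar>D s\<bar> \<le> 1" and H: "H \<in> events" and c: "0 < c"
        and dec: "\<And>U W. \<bar>prob (H \<inter> profile X Y ?J U W) - c * prob (profile X Y ?J U W)\<bar>
          \<le> \<delta> * c * prob (profile X Y ?J U W)" for D H c
    proof -
      have "\<bar>(\<integral>x. indicator H x * f D ?J x \<partial>M) - c * (\<integral>x. f D ?J x \<partial>M)\<bar>
          \<le> (\<delta> * c) * (\<integral>x. \<bar>f D ?J x\<bar> \<partial>M)"
        unfolding f_def by (rule profile_decoupling[OF ev _ H dec]) auto
      also have "(\<integral>x. \<bar>f D ?J x\<bar> \<partial>M) \<le> (\<integral>x. 1 \<partial>M)"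
        using f_le[of D, OF D] f_int[of D, OF D] by (intro integral_mono) auto
      finally show ?thesis using c pos by (simp add: prob_space mult_left_mono)
    qed
    \<comment> \<open>The decoupled contributions of marks and hazards cancel pointwise.\<close>
    have "\<alpha> * (\<integral>x. f D1 ?J x \<partial>M) + \<beta> * (\<integral>x. f D2 ?J x \<partial>M) = (\<integral>x. \<alpha> * f D1 ?J x + \<beta> * f D2 ?J x \<partial>M)"
      using f_int[of D1, OF D1_le] f_int[of D2, OF D2_le] by simp
    also have "\<dots> = (\<integral>x. 0 \<partial>M)"
      using balance by (intro Bochner_Integration.integral_cong) (auto simp: f_eq)
    finally have cancel: "\<alpha> * (\<integral>x. f D1 ?J x \<partial>M) + \<beta> * (\<integral>x. f D2 ?J x \<partial>M) = 0" by simp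
    have "\<bar>d k\<bar> \<le> 2 * prob (X k \<inter> ?R) + 2 * prob (Y k \<inter> ?R) + \<delta> * \<alpha> + \<delta> * \<beta>"
      unfolding d_eq
      using remove[of D1, OF D1_le ev(1)[of k]] remove[of D2, OF D2_le ev(2)[of k]]
        decouple[of D1, OF D1_le ev(1) pos(1) decX[OF k]] decouple[of D2, OF D2_le ev(2) pos(2) decY[OF k]] cancel
      by linarith
    also have "\<dots> \<le> 2 * (\<theta> * \<alpha>) + 2 * (\<theta> * \<beta>) + \<delta> * \<alpha> + \<delta> * \<beta>"
      using ovX[OF k] ovY[OF k] by linarith
    finally show ?thesis by (simp add: algebra_simps)
  qed

  have survive: "prob (A (g + t)) \<le> 2 / (\<beta> * t) + 2 * \<theta>"
  proof -
    have hit: "\<beta> / 2 * prob (A (g + t)) - \<theta> * \<beta> \<le> prob (Y k \<inter> A k)" if k: "k \<in> {g..<g + t}" for k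
    proof -
      let ?J = "{..<k} - B k" and ?R = "\<Union>j\<in>{..<k} \<inter> B k. X j \<union> Y j"
      define A' where "A' = {x \<in> space M. \<forall>j\<in>?J. x \<notin> Y j}"
      have A' [measurable]: "A' \<in> events" unfolding A'_def by measurable
      have R_ev: "?R \<in> events" using ev by auto
      have f1: "f (\<lambda>_. 1) ?J x = indicator A' x" if "x \<in> space M" for x
        using that by (auto simp: f_eq A'_def)
      have e1: "(\<integral>x. indicator H x * f (\<lambda>_. 1) ?J x \<partial>M) = prob (H \<inter> A')" if "H \<in> events" for H
      proof -
        have "(\<integral>x. indicator H x * f (\<lambda>_. 1) ?J x \<partial>M) = (\<integral>x. indicator (H \<inter> A') x \<partial>M)"
          by (intro Bochner_Integration.integral_cong) (auto simp: f1 indicator_def)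
        then show ?thesis using that by simp
      qed
      have e2: "(\<integral>x. f (\<lambda>_. 1) ?J x \<partial>M) = prob A'"
        using A' by (subst Bochner_Integration.integral_cong[OF refl f1]) auto
      have e3: "(\<integral>x. \<bar>f (\<lambda>_. 1) ?J x\<bar> \<partial>M) = prob A'"
        unfolding e2[symmetric] by (intro Bochner_Integration.integral_cong) (auto simp: f1)
      have "\<bar>prob (Y k \<inter> A') - \<beta> * prob A'\<bar> \<le> (\<delta> * \<beta>) * prob A'"
        using profile_decoupling[OF ev _ ev(2) decY, of k "F (\<lambda>_. 1)"] k
        unfolding f_def[symmetric] e1[OF ev(2)] e2 e3 by simp
      moreover have "\<delta> * \<beta> * prob A' \<le> 1 / 2 * \<beta> * prob A'"
        using pos by (intro mult_right_mono) auto
      ultimately have "\<beta> / 2 * prob A' \<le> prob (Y k \<inter> A')" by linarith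
      also have "\<dots> \<le> prob (Y k \<inter> A k \<union> Y k \<inter> ?R)"
        using R_ev by (intro finite_measure_mono) (auto simp: A'_def A_def)
      also have "\<dots> \<le> prob (Y k \<inter> A k) + prob (Y k \<inter> ?R)"
        using R_ev by (intro measure_Un_le) auto
      also have "\<dots> \<le> prob (Y k \<inter> A k) + \<theta> * \<beta>"
        using ovY[of k] k by simp
      finally have "\<beta> / 2 * prob A' - \<theta> * \<beta> \<le> prob (Y k \<inter> A k)" by simp
      moreover have "prob (A (g + t)) \<le> prob A'"
        using k by (intro finite_measure_mono) (auto simp: A_def A'_def)
      then have "\<beta> / 2 * prob (A (g + t)) \<le> \<beta> / 2 * prob A'"
        using pos by (intro mult_left_mono) auto
      ultimately show ?thesis by linarith
    qed
    have "t * (\<beta> / 2 * prob (A (g + t)) - \<theta> * \<beta>) = (\<Sum>k\<in>{g..<g + t}. \<beta> / 2 * prob (A (g + t)) - \<theta> * \<beta>)"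
      by simp
    also have "\<dots> \<le> (\<Sum>k\<in>{g..<g + t}. prob (Y k \<inter> A k))"
      by (rule sum_mono[OF hit])
    also have "\<dots> = prob (\<Union>k\<in>{g..<g + t}. Y k \<inter> A k)"
    proof (rule finite_measure_finite_Union[symmetric])
      show "disjoint_family_on (\<lambda>k. Y k \<inter> A k) {g..<g + t}"
        unfolding disjoint_family_on_def A_def by (auto, metis linorder_neqE_nat)
    qed auto
    also have "\<dots> \<le> 1" by simp
    finally have "t * (\<beta> / 2 * prob (A (g + t)) - \<theta> * \<beta>) \<le> 1" .
    then have "prob (A (g + t)) * (\<beta> * t) \<le> 2 + 2 * \<theta> * (\<beta> * t)" by (simp add: algebra_simps)
    then have "prob (A (g + t)) \<le> (2 + 2 * \<theta> * (\<beta> * t)) / (\<beta> * t)"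
      using pos by (subst pos_le_divide_eq) auto
    also have "\<dots> = 2 / (\<beta> * t) + 2 * \<theta>" using pos by (simp add: add_divide_distrib)
    finally show ?thesis .
  qed

  have start: "(\<integral>x. V 0 x \<partial>M) = \<phi> 0" by (simp add: V_def S_def prob_space)
  have telescope: "(\<integral>x. V k x \<partial>M) - \<phi> 0 = (\<Sum>i<k. d i)" for k
    unfolding d_def start[symmetric] by (rule sum_lessThan_telescope[symmetric])
  have "\<bar>(\<integral>x. V (g + t) x \<partial>M) - \<phi> 0\<bar> \<le> (\<Sum>i<g + t. \<bar>d i\<bar>)"
    unfolding telescope by (rule sum_abs)
  also have "\<dots> = (\<Sum>i<g. \<bar>d i\<bar>) + (\<Sum>i\<in>{g..<g + t}. \<bar>d i\<bar>)"
    by (subst sum.union_disjoint[symmetric]) (auto intro!: sum.cong)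
  also have "\<dots> \<le> (\<Sum>k<g. prob (X k) + prob (Y k)) + (\<Sum>i\<in>{g..<g + t}. (\<alpha> + \<beta>) * (2 * \<theta> + \<delta>))"
    by (intro add_mono sum_mono d_trivial d_small) auto
  finally have main: "\<bar>(\<integral>x. V (g + t) x \<partial>M) - \<phi> 0\<bar>
      \<le> (\<Sum>k<g. prob (X k) + prob (Y k)) + t * (\<alpha> + \<beta>) * (2 * \<theta> + \<delta>)"
    by (simp add: mult.assoc)
  have "prob (Sig -` G \<inter> space M) - (\<integral>x. V (g + t) x \<partial>M)
      = (\<integral>x. indicator (Sig -` G \<inter> space M) x - V (g + t) x \<partial>M)"
    using V_int by (simp add: emeasure_eq_measure)
  also have "\<bar>\<dots>\<bar> \<le> (\<integral>x. indicator (A (g + t)) x \<partial>M)"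
  proof (intro order_trans[OF integral_abs_bound] integral_mono)
    fix x assume "x \<in> space M"
    then show "\<bar>indicator (Sig -` G \<inter> space M) x - V (g + t) x\<bar> \<le> (indicator (A (g + t)) x :: real)"
      using \<phi>01 by (auto simp: V_def A_def indicator_def)
  qed (use V_int in \<open>auto simp: emeasure_eq_measure intro!: integrable_abs Bochner_Integration.integrable_diff\<close>)
  finally have "\<bar>prob (Sig -` G \<inter> space M) - (\<integral>x. V (g + t) x \<partial>M)\<bar> \<le> prob (A (g + t))"
    by simp
  moreover have "\<phi> 0 = measure_pmf.prob (geometric_pmf \<rho>) (enat -` G)"
    by (simp add: \<phi>_def vimage_def)
  ultimately show ?thesis
    using main survive unfolding \<rho>_def by linarith
qed

end

section \<open>Events determined by finitely many coordinates, and mixing\<close>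

text \<open>For countable \<open>A\<close> and finite \<open>I\<close> there are countably many sets \<open>agree A I w\<close>, and every event that is determined
by the coordinates in \<open>I\<close> is a disjoint union of them. Inequalities between measures can therefore be checked
on these sets alone, which replaces a monotone class argument.\<close>

definition agree :: "'a set \<Rightarrow> nat set \<Rightarrow> (nat \<Rightarrow> 'a) \<Rightarrow> (nat \<Rightarrow> 'a) set" where
  "agree A I w = {x \<in> Omega A. \<forall>i\<in>I. x i = w i}"

definition determined :: "'a set \<Rightarrow> nat set \<Rightarrow> (nat \<Rightarrow> 'a) set \<Rightarrow> bool" where
  "determined A I E \<longleftrightarrow> E \<subseteq> Omega A \<and> (\<forall>x\<in>E. \<forall>y\<in>Omega A. (\<forall>i\<in>I. x i = y i) \<longrightarrow> y \<in> E)"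

lemma Omega_iff: "x \<in> Omega A \<longleftrightarrow> (\<forall>i. x i \<in> A)"
  by (auto simp: Omega_def)

lemma determined_agree: "determined A I (agree A I w)"
  by (auto simp: determined_def agree_def)

lemma determined_mono: "determined A I E \<Longrightarrow> I \<subseteq> J \<Longrightarrow> determined A J E"
  unfolding determined_def by blast

lemma determined_Int: "determined A I E \<Longrightarrow> determined A J F \<Longrightarrow> determined A (I \<union> J) (E \<inter> F)"
  unfolding determined_def by blast

lemma determined_INT:
  assumes "\<And>k. k \<in> K \<Longrightarrow> determined A (I k) (E k)"
  shows "determined A (\<Union>k\<in>K. I k) {x \<in> Omega A. \<forall>k\<in>K. x \<in> E k}"
  unfolding determined_def
proof (intro conjI ballI impI)
  fix x y assume x: "x \<in> {x \<in> Omega A. \<forall>k\<in>K. x \<in> E k}" and y: "y \<in> Omega A"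
    and eq: "\<forall>i\<in>\<Union>(I ` K). x i = y i"
  have "y \<in> E k" if "k \<in> K" for k
    using assms[OF that] x y eq that unfolding determined_def by blast
  with y show "y \<in> {x \<in> Omega A. \<forall>k\<in>K. x \<in> E k}" by blast
qed blast

lemma agree_in_coord_algebra:
  assumes "finite I" "w \<in> Omega A"
  shows "agree A I w \<in> coord_algebra A I"
proof -
  interpret S: sigma_algebra "Omega A" "coord_algebra A I"
    unfolding coord_algebra_def by (rule sigma_algebra_sigma_sets) auto
  have gen: "{x \<in> Omega A. x i = w i} \<in> coord_algebra A I" if "i \<in> I" for i
  proof -
    have "{x \<in> Omega A. x i = w i} = {x \<in> Omega A. x i \<in> {w i}}" by auto
    moreover have "{w i} \<subseteq> A" using assms(2) by (auto simp: Omega_iff)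
    ultimately show ?thesis using that unfolding coord_algebra_def
      by (intro sigma_sets.Basic) blast
  qed
  show ?thesis
  proof (cases "I = {}")
    case True
    then show ?thesis using S.top by (simp add: agree_def)
  next
    case False
    then have "agree A I w = (\<Inter>i\<in>I. {x \<in> Omega A. x i = w i})" by (auto simp: agree_def)
    then show ?thesis using False assms(1) gen by (auto intro!: S.finite_INT)
  qed
qed

lemma countable_agree_classes:
  assumes "countable A" "finite I"
  shows "countable (agree A I ` Omega A)"
proof -
  have "agree A I w = agree A I (restrict w I)" for w
    by (auto simp: agree_def)
  then have "agree A I ` Omega A \<subseteq> agree A I ` (I \<rightarrow>\<^sub>E A)"
    by (auto simp: Omega_iff image_iff intro!: bexI[of _ "restrict _ I"])
  moreover have "countable (I \<rightarrow>\<^sub>E A)" using assms by (intro countable_PiE) auto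
  ultimately show ?thesis by (meson countable_image countable_subset)
qed

lemma determined_eq_Union:
  assumes "determined A I E"
  shows "E = \<Union>(agree A I ` E)"
  using assms by (auto simp: determined_def agree_def)

lemma determined_in_coord_algebra:
  assumes "countable A" "finite I" "determined A I E"
  shows "E \<in> coord_algebra A I"
proof -
  interpret S: sigma_algebra "Omega A" "coord_algebra A I"
    unfolding coord_algebra_def by (rule sigma_algebra_sigma_sets) auto
  have E: "E \<subseteq> Omega A" using assms(3) by (auto simp: determined_def)
  then have "countable (agree A I ` E)"
    by (meson assms(1,2) countable_agree_classes countable_subset image_mono)
  then have "\<Union>(agree A I ` E) \<in> coord_algebra A I"
    using E agree_in_coord_algebra[OF assms(2)] by (intro S.countable_Union) auto
  then show ?thesis using determined_eq_Union[OF assms(3)] by simp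
qed

lemma coord_algebra_mono: "I \<subseteq> J \<Longrightarrow> coord_algebra A I \<subseteq> coord_algebra A J"
  unfolding coord_algebra_def by (intro sigma_sets_mono') blast

locale shift_system = prob_space P for P :: "(nat \<Rightarrow> 'a) measure" +
  fixes A :: "'a set"
  assumes countable_A: "countable A"
    and sets_P: "sets P = sets (seq_space A)"
    and invariant: "distr P P shift = P"
begin

lemma space_P: "space P = Omega A"
  using sets_eq_imp_space_eq[OF sets_P] by (simp add: seq_space_def space_PiM Omega_def)

lemma coord_algebra_events: "coord_algebra A I \<subseteq> events"
proof -
  have "{x \<in> Omega A. x i \<in> B} \<in> events" if "B \<subseteq> A" for i B
  proof -
    have "(\<lambda>x. x i) \<in> P \<rightarrow>\<^sub>M count_space A"
      by (subst measurable_cong_sets[OF sets_P refl]) (simp add: seq_space_def)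
    from measurable_sets[OF this, of B] that show ?thesis
      by (simp add: space_P vimage_def Int_def conj_commute)
  qed
  then show ?thesis
    unfolding coord_algebra_def space_P[symmetric] by (intro sets.sigma_sets_subset) auto
qed

lemma determined_events:
  assumes "finite I" "determined A I E"
  shows "E \<in> events"
  using determined_in_coord_algebra[OF countable_A assms] coord_algebra_events by blast

text \<open>An inequality between two measures passes from the atoms to all determined events by countable additivity.
On an atom the conditions on coordinates to the left and to the right of a window separate into an
intersection, which is the only form that the mixing coefficient can be applied to.\<close>

lemma prob_determined_mono:
  assumes fin: "finite I" and E: "determined A I E" and H: "H1 \<in> events" "H2 \<in> events"
    and c: "0 \<le> c1" "0 \<le> c2"
    and le: "\<And>w. w \<in> Omega A \<Longrightarrow> c1 * prob (H1 \<inter> agree A I w) \<le> c2 * prob (H2 \<inter> agree A I w)"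
  shows "c1 * prob (H1 \<inter> E) \<le> c2 * prob (H2 \<inter> E)"
proof -
  let ?K = "agree A I ` E"
  have sub: "E \<subseteq> Omega A" using E by (auto simp: determined_def)
  then have cnt: "countable ?K"
    by (meson countable_A fin countable_agree_classes countable_subset image_mono)
  have ev: "k \<in> events" if "k \<in> ?K" for k
    using that fin determined_agree determined_events by blast
  have disj: "disjoint_family_on (\<lambda>k. H \<inter> k) ?K" for H
    unfolding disjoint_family_on_def by (auto simp: agree_def)
  have exp: "emeasure P (H \<inter> E) = (\<integral>\<^sup>+k. emeasure P (H \<inter> k) \<partial>count_space ?K)" if "H \<in> events" for H
  proof -
    have "H \<inter> E = (\<Union>k\<in>?K. H \<inter> k)" using determined_eq_Union[OF E] by blast
    also have "emeasure P \<dots> = (\<integral>\<^sup>+k. emeasure P (H \<inter> k) \<partial>count_space ?K)"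
      using that ev cnt disj by (intro emeasure_UN_countable) auto
    finally show ?thesis .
  qed
  have "ennreal (c1 * prob (H1 \<inter> E)) = ennreal c1 * emeasure P (H1 \<inter> E)"
    using c by (simp add: emeasure_eq_measure ennreal_mult)
  also have "\<dots> = (\<integral>\<^sup>+k. ennreal c1 * emeasure P (H1 \<inter> k) \<partial>count_space ?K)"
    unfolding exp[OF H(1)] by (rule nn_integral_cmult[symmetric]) simp
  also have "\<dots> \<le> (\<integral>\<^sup>+k. ennreal c2 * emeasure P (H2 \<inter> k) \<partial>count_space ?K)"
  proof (rule nn_integral_mono)
    fix k assume "k \<in> space (count_space ?K)"
    then obtain w where w: "w \<in> Omega A" "k = agree A I w" using sub by auto
    have "ennreal (c1 * prob (H1 \<inter> k)) \<le> ennreal (c2 * prob (H2 \<inter> k))"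
      unfolding w(2) by (intro ennreal_leI le w(1))
    then show "ennreal c1 * emeasure P (H1 \<inter> k) \<le> ennreal c2 * emeasure P (H2 \<inter> k)"
      using c by (simp add: emeasure_eq_measure ennreal_mult)
  qed
  also have "\<dots> = ennreal c2 * emeasure P (H2 \<inter> E)"
    unfolding exp[OF H(2)] by (rule nn_integral_cmult) simp
  also have "\<dots> = ennreal (c2 * prob (H2 \<inter> E))"
    using c by (simp add: emeasure_eq_measure ennreal_mult)
  finally show ?thesis using c by (subst (asm) ennreal_le_iff) auto
qed

text \<open>The mixing coefficient compares initial segments of coordinates with tails; the case distinction on \<open>L\<close> is
there because an empty past has no last coordinate.\<close>

lemma psi_mixing_determined:
  assumes fin: "psi A P g < \<infinity>" and L: "finite L" "determined A L E" and R: "finite R" "determined A R F"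
    and gap: "\<And>a b. a \<in> L \<Longrightarrow> b \<in> R \<Longrightarrow> a + g \<le> b"
  shows "\<bar>prob (E \<inter> F) - prob E * prob F\<bar> \<le> enn2real (psi A P g) * (prob E * prob F)"
proof (cases "L = {}")
  case True
  then consider "E = {}" | "E = Omega A" using L(2) unfolding determined_def by auto
  then show ?thesis
  proof cases
    case 2
    moreover have "F \<subseteq> Omega A" using R by (simp add: determined_def)
    then have "Omega A \<inter> F = F" by blast
    ultimately show ?thesis using prob_space by (simp add: space_P)
  qed simp
next
  case False
  have ev: "E \<in> events" "F \<in> events" using L R determined_events by auto
  let ?e = "Max L"
  have E: "E \<in> coord_algebra A {0..?e}"
    using determined_in_coord_algebra[OF countable_A L] coord_algebra_mono[of L "{0..?e}" A] L(1)
    by (auto simp: subset_iff)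
  have F: "F \<in> coord_algebra A {?e + g..}"
    using determined_in_coord_algebra[OF countable_A R] coord_algebra_mono[of R "{?e + g..}" A]
      gap[OF Max_in[OF L(1) False]] by (auto simp: subset_iff)
  show ?thesis
  proof (cases "prob E * prob F = 0")
    case True
    have "prob (E \<inter> F) \<le> prob E" "prob (E \<inter> F) \<le> prob F"
      using ev by (auto intro!: finite_measure_mono)
    with True have "prob (E \<inter> F) = 0"
      by (auto intro!: antisym[OF _ measure_nonneg])
    then show ?thesis unfolding True by simp
  next
    case nz: False
    then have pos: "0 < prob E * prob F" by (simp add: zero_less_measure_iff)
    have "ennreal \<bar>prob (E \<inter> F) / (prob E * prob F) - 1\<bar> \<le> psi_dep P (coord_algebra A {0..?e}) (coord_algebra A {?e + g..})"
      unfolding psi_dep_def using E F nz by (intro SUP_upper2[of "(E, F)"]) auto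
    also have "\<dots> \<le> psi A P g" unfolding psi_def by (rule SUP_upper) simp
    also have "\<dots> = ennreal (enn2real (psi A P g))" using fin by simp
    finally have "\<bar>prob (E \<inter> F) / (prob E * prob F) - 1\<bar> \<le> enn2real (psi A P g)"
      by (subst (asm) ennreal_le_iff) auto
    then have "\<bar>prob (E \<inter> F) / (prob E * prob F) - 1\<bar> * (prob E * prob F) \<le> enn2real (psi A P g) * (prob E * prob F)"
      using pos by (intro mult_right_mono) auto
    moreover have "\<bar>prob (E \<inter> F) / (prob E * prob F) - 1\<bar> * (prob E * prob F) = \<bar>prob (E \<inter> F) - prob E * prob F\<bar>"
    proof -
      have "\<bar>prob (E \<inter> F) / (prob E * prob F) - 1\<bar> * (prob E * prob F)
          = \<bar>(prob (E \<inter> F) / (prob E * prob F) - 1) * (prob E * prob F)\<bar>"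
        by (simp add: abs_mult)
      also have "(prob (E \<inter> F) / (prob E * prob F) - 1) * (prob E * prob F) = prob (E \<inter> F) - prob E * prob F"
        using nz by (simp add: field_simps)
      finally show ?thesis .
    qed
    ultimately show ?thesis by simp
  qed
qed

text \<open>A window in the middle of the coordinates: on an atom, peel off first the part on the left and then the part on
the right, and compare with the product formula for left and right without the window. This gives the ratio
bounds \<open>(1 + u)\<^sup>2 / (1 - u)\<close> and \<open>(1 - u)\<^sup>2 / (1 + u)\<close>, which lie within \<open>5 * u\<close> of 1 when \<open>u \<le> 1 / 4\<close>.\<close>

lemma decouple_window:
  assumes fin: "psi A P g < \<infinity>" and u: "enn2real (psi A P g) \<le> 1 / 4"
    and J: "finite J" "J \<noteq> {}" "determined A J H" and I: "finite I" "determined A I E"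
    and gap: "\<And>i. i \<in> I \<Longrightarrow> (\<forall>j\<in>J. i + g \<le> j) \<or> (\<forall>j\<in>J. j + g \<le> i)"
  shows "\<bar>prob (H \<inter> E) - prob H * prob E\<bar> \<le> 5 * enn2real (psi A P g) * (prob H * prob E)"
proof -
  define u where "u = enn2real (psi A P g)"
  have u0: "0 \<le> u" "u \<le> 1 / 4" using u by (auto simp: u_def)
  define L where "L = {i \<in> I. \<forall>j\<in>J. i + g \<le> j}"
  define R where "R = {i \<in> I. \<forall>j\<in>J. j + g \<le> i}"
  have LR: "finite L" "finite R" "I = L \<union> R" using I(1) gap by (auto simp: L_def R_def)
  have H: "H \<in> events" using determined_events J by blast
  \<comment> \<open>Both inequalities are kept free of divisions, in the form that \<open>prob_determined_mono\<close> extends.\<close>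
  have atom: "(1 - u) * prob (H \<inter> agree A I w) \<le> (1 + u)\<^sup>2 * prob H * prob (agree A I w)
      \<and> (1 - u)\<^sup>2 * prob H * prob (agree A I w) \<le> (1 + u) * prob (H \<inter> agree A I w)" for w
  proof -
    let ?l = "agree A L w" and ?r = "agree A R w"
    have split: "agree A I w = ?l \<inter> ?r" by (auto simp: agree_def LR(3))
    have lr: "\<bar>prob (?l \<inter> ?r) - prob ?l * prob ?r\<bar> \<le> u * (prob ?l * prob ?r)"
      unfolding u_def
    proof (rule psi_mixing_determined[OF fin LR(1) determined_agree LR(2) determined_agree])
      fix a b assume "a \<in> L" "b \<in> R"
      moreover obtain j where "j \<in> J" using J by blast
      ultimately have "a + g \<le> j" "j + g \<le> b" by (auto simp: L_def R_def)
      then show "a + g \<le> b" by linarith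
    qed
    have hr: "\<bar>prob (H \<inter> ?r) - prob H * prob ?r\<bar> \<le> u * (prob H * prob ?r)"
      unfolding u_def
      by (rule psi_mixing_determined[OF fin J(1,3) LR(2) determined_agree]) (auto simp: R_def)
    have lhr: "\<bar>prob (?l \<inter> (H \<inter> ?r)) - prob ?l * prob (H \<inter> ?r)\<bar> \<le> u * (prob ?l * prob (H \<inter> ?r))"
      unfolding u_def
    proof (rule psi_mixing_determined[OF fin LR(1) determined_agree _ determined_Int[OF J(3) determined_agree]])
      fix a b assume "a \<in> L" "b \<in> J \<union> R"
      moreover obtain j where "j \<in> J" using J by blast
      ultimately have "a + g \<le> j" "b \<in> R \<Longrightarrow> j + g \<le> b" "b \<in> J \<Longrightarrow> a + g \<le> b" by (auto simp: L_def R_def)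
      then show "a + g \<le> b" using \<open>b \<in> J \<union> R\<close> by auto
    qed (use J LR in auto)
    have eq: "?l \<inter> (H \<inter> ?r) = H \<inter> agree A I w" unfolding split by auto
    let ?p = "prob ?l" and ?q = "prob ?r" and ?h = "prob H"
    have nn: "0 \<le> ?p" "0 \<le> ?q" "0 \<le> ?h" by auto
    have a1: "(1 - u) * (?p * ?q) \<le> prob (agree A I w)" "prob (agree A I w) \<le> (1 + u) * (?p * ?q)"
      using lr unfolding split[symmetric] by (auto simp: abs_le_iff algebra_simps)
    have a2: "(1 - u) * (?h * ?q) \<le> prob (H \<inter> ?r)" "prob (H \<inter> ?r) \<le> (1 + u) * (?h * ?q)"
      using hr by (auto simp: abs_le_iff algebra_simps)
    have a3: "(1 - u) * (?p * prob (H \<inter> ?r)) \<le> prob (H \<inter> agree A I w)"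
      "prob (H \<inter> agree A I w) \<le> (1 + u) * (?p * prob (H \<inter> ?r))"
      using lhr unfolding eq by (auto simp: abs_le_iff algebra_simps)
    have "(1 - u) * prob (H \<inter> agree A I w) \<le> (1 - u) * ((1 + u) * (?p * ((1 + u) * (?h * ?q))))"
      using u0 nn by (intro mult_left_mono order_trans[OF a3(2)] mult_left_mono a2(2)) auto
    also have "\<dots> = (1 + u)\<^sup>2 * ?h * ((1 - u) * (?p * ?q))" by (simp add: power2_eq_square algebra_simps)
    also have "\<dots> \<le> (1 + u)\<^sup>2 * ?h * prob (agree A I w)"
      using nn by (intro mult_left_mono a1(1)) auto
    finally have c1: "(1 - u) * prob (H \<inter> agree A I w) \<le> (1 + u)\<^sup>2 * ?h * prob (agree A I w)" .
    have "(1 - u)\<^sup>2 * ?h * prob (agree A I w) \<le> (1 - u)\<^sup>2 * ?h * ((1 + u) * (?p * ?q))"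
      using nn by (intro mult_left_mono a1(2)) auto
    also have "\<dots> = (1 + u) * ((1 - u) * (?p * ((1 - u) * (?h * ?q))))" by (simp add: power2_eq_square algebra_simps)
    also have "\<dots> \<le> (1 + u) * ((1 - u) * (?p * prob (H \<inter> ?r)))"
      using u0 nn by (intro mult_left_mono a2(1)) auto
    also have "\<dots> \<le> (1 + u) * prob (H \<inter> agree A I w)"
      using u0 by (intro mult_left_mono a3(1)) auto
    finally show ?thesis using c1 by blast
  qed
  have E_sub: "space P \<inter> E = E" using I by (auto simp: space_P determined_def)
  have [simp]: "space P \<inter> agree A I w = agree A I w" for w by (auto simp: space_P agree_def)
  have up: "(1 - u) * prob (H \<inter> E) \<le> ((1 + u)\<^sup>2 * prob H) * prob (space P \<inter> E)"
    using u0 atom by (intro prob_determined_mono[OF I H sets.top]) auto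
  have lo: "((1 - u)\<^sup>2 * prob H) * prob (space P \<inter> E) \<le> (1 + u) * prob (H \<inter> E)"
    using u0 atom by (intro prob_determined_mono[OF I sets.top H]) auto
  define z where "z = prob H * prob E"
  have z0: "0 \<le> z" by (simp add: z_def)
  have "(1 + u)\<^sup>2 \<le> (1 - u) * (1 + 5 * u)"
  proof -
    have "u * u \<le> 1 / 4 * u" using u0 by (intro mult_right_mono) auto
    then show ?thesis using u0 by (simp add: power2_eq_square algebra_simps)
  qed
  then have "(1 + u)\<^sup>2 * z \<le> (1 - u) * (1 + 5 * u) * z" by (rule mult_right_mono[OF _ z0])
  then have "(1 - u) * prob (H \<inter> E) \<le> (1 - u) * ((1 + 5 * u) * z)"
    using up unfolding E_sub z_def by (simp add: mult.assoc)
  then have 1: "prob (H \<inter> E) \<le> (1 + 5 * u) * z"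
    using u0 by (subst (asm) mult_le_cancel_left_pos) auto
  have "(1 + u) * (1 - 5 * u) \<le> (1 - u)\<^sup>2"
    using u0 by (simp add: power2_eq_square algebra_simps)
  then have "(1 + u) * (1 - 5 * u) * z \<le> (1 - u)\<^sup>2 * z" by (rule mult_right_mono[OF _ z0])
  then have "(1 + u) * ((1 - 5 * u) * z) \<le> (1 + u) * prob (H \<inter> E)"
    using lo unfolding E_sub z_def by (simp add: mult.assoc)
  then have 2: "(1 - 5 * u) * z \<le> prob (H \<inter> E)"
    using u0 by (subst (asm) mult_le_cancel_left_pos) auto
  show ?thesis
    using 1 2 unfolding u_def[symmetric] z_def[symmetric] by (simp add: abs_le_iff algebra_simps)
qed

text \<open>Windows are detached one at a time: those not yet detached count as part of the remaining event.\<close>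

lemma decouple_windows:
  assumes fin: "psi A P g < \<infinity>" and u: "enn2real (psi A P g) \<le> 1 / 4"
    and K: "finite K"
    and J: "\<And>k. k \<in> K \<Longrightarrow> finite (J k) \<and> J k \<noteq> {} \<and> determined A (J k) (H k) \<and> prob (H k) = a"
    and I: "finite I" "determined A I E"
    and gapI: "\<And>i k. k \<in> K \<Longrightarrow> i \<in> I \<Longrightarrow> (\<forall>j\<in>J k. i + g \<le> j) \<or> (\<forall>j\<in>J k. j + g \<le> i)"
    and gapJ: "\<And>k k' i. k \<in> K \<Longrightarrow> k' \<in> K \<Longrightarrow> k \<noteq> k' \<Longrightarrow> i \<in> J k' \<Longrightarrow>
        (\<forall>j\<in>J k. i + g \<le> j) \<or> (\<forall>j\<in>J k. j + g \<le> i)"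
  shows "\<bar>prob ({x \<in> Omega A. \<forall>k\<in>K. x \<in> H k} \<inter> E) - a ^ card K * prob E\<bar>
    \<le> ((1 + 5 * enn2real (psi A P g)) ^ card K - 1) * (a ^ card K * prob E)"
  using K J gapI gapJ
proof (induction K rule: finite_induct)
  case empty
  have "Omega A \<inter> E = E" using I by (auto simp: determined_def)
  then show ?case by simp
next
  case (insert k K)
  define u where "u = 5 * enn2real (psi A P g)"
  have u0: "0 \<le> u" by (simp add: u_def)
  define E' where "E' = {x \<in> Omega A. \<forall>k\<in>K. x \<in> H k} \<inter> E"
  have IH: "\<bar>prob E' - a ^ card K * prob E\<bar> \<le> ((1 + u) ^ card K - 1) * (a ^ card K * prob E)"
    unfolding E'_def u_def
    by (intro insert.IH insert.prems(1) insert.prems(2) insert.prems(3)) (assumption | rule insertI2)+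
  have Hk: "finite (J k)" "J k \<noteq> {}" "determined A (J k) (H k)" "prob (H k) = a"
    using insert.prems(1)[of k] by auto
  have E'_det: "determined A ((\<Union>k\<in>K. J k) \<union> I) E'"
    unfolding E'_def using insert.prems(1) by (intro determined_Int determined_INT I) auto
  have step: "\<bar>prob (H k \<inter> E') - a * prob E'\<bar> \<le> u * (a * prob E')"
    unfolding u_def Hk(4)[symmetric]
  proof (rule decouple_window[OF fin u Hk(1-3) _ E'_det])
    show "finite ((\<Union>k\<in>K. J k) \<union> I)" using insert.hyps insert.prems(1) I by auto
    fix i assume "i \<in> (\<Union>k\<in>K. J k) \<union> I"
    then show "(\<forall>j\<in>J k. i + g \<le> j) \<or> (\<forall>j\<in>J k. j + g \<le> i)"
    proof
      assume "i \<in> (\<Union>k\<in>K. J k)"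
      then obtain k' where "k' \<in> K" "i \<in> J k'" by blast
      then show ?thesis using insert.hyps insert.prems(3)[of k k' i] by auto
    qed (use insert.prems(2)[of k] in auto)
  qed
  have eq: "{x \<in> Omega A. \<forall>k\<in>insert k K. x \<in> H k} \<inter> E = H k \<inter> E'"
    by (auto simp: E'_def)
  have card: "card (insert k K) = Suc (card K)" using insert.hyps by simp
  have a0: "0 \<le> a" unfolding Hk(4)[symmetric] by simp
  define z where "z = a ^ card K * prob E"
  have IH': "\<bar>prob E' - z\<bar> \<le> ((1 + u) ^ card K - 1) * z" using IH by (simp add: z_def)
  have "\<bar>a * prob E' - a * z\<bar> = a * \<bar>prob E' - z\<bar>"
    using a0 by (simp add: abs_mult right_diff_distrib[symmetric])
  also have "\<dots> \<le> a * (((1 + u) ^ card K - 1) * z)" using a0 IH' by (rule mult_left_mono[rotated])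
  finally have 1: "\<bar>a * prob E' - a * z\<bar> \<le> ((1 + u) ^ card K - 1) * (a * z)" by (simp add: algebra_simps)
  have "prob E' \<le> (1 + u) ^ card K * z" using IH' by (simp add: abs_le_iff algebra_simps)
  then have "u * (a * prob E') \<le> u * (a * ((1 + u) ^ card K * z))"
    using a0 u0 by (intro mult_left_mono) auto
  then have "\<bar>prob (H k \<inter> E') - a * z\<bar> \<le> u * (a * ((1 + u) ^ card K * z)) + ((1 + u) ^ card K - 1) * (a * z)"
    using step 1 by linarith
  also have "\<dots> = ((1 + u) ^ Suc (card K) - 1) * (a * z)" by (simp add: algebra_simps)
  finally show ?case unfolding eq card u_def[symmetric] by (simp add: z_def mult.assoc)
qed

end

section \<open>Occurrences of words and their overlaps\<close>

lemma shift_funpow: "(shift ^^ s) x = (\<lambda>i. x (s + i))"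
  by (induction s) (auto simp: shift_def fun_eq_iff)

lemma initial_cyl_iff: "x \<in> initial_cyl A \<omega> n \<longleftrightarrow> x \<in> Omega A \<and> (\<forall>i<n. x i = \<omega> i)"
  by (auto simp: initial_cyl_def cyl_def)

lemma initial_cyl_cylinders: "\<omega> \<in> Omega A \<Longrightarrow> initial_cyl A \<omega> n \<in> cylinders A n"
  unfolding initial_cyl_def cylinders_def
  by (auto simp: Omega_iff intro!: exI[of _ "map \<omega> [0..<n]"])

definition occurs :: "'a set \<Rightarrow> (nat \<Rightarrow> 'a) \<Rightarrow> nat \<Rightarrow> nat \<Rightarrow> (nat \<Rightarrow> 'a) set" where
  "occurs A \<omega> n s = {x \<in> Omega A. (shift ^^ s) x \<in> initial_cyl A \<omega> n}"

lemma occurs_iff: "x \<in> occurs A \<omega> n s \<longleftrightarrow> x \<in> Omega A \<and> (\<forall>i<n. x (s + i) = \<omega> i)"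
  by (auto simp: occurs_def initial_cyl_iff shift_funpow Omega_iff)

lemma determined_occurs: "determined A {s..<s + n} (occurs A \<omega> n s)"
  unfolding determined_def
proof (intro conjI ballI impI)
  fix x y assume x: "x \<in> occurs A \<omega> n s" and y: "y \<in> Omega A" and eq: "\<forall>i\<in>{s..<s + n}. x i = y i"
  have "y (s + i) = \<omega> i" if "i < n" for i
    using x eq that by (metis atLeastLessThan_iff le_add1 nat_add_left_cancel_less occurs_iff)
  with y show "y \<in> occurs A \<omega> n s" by (simp add: occurs_iff)
qed (auto simp: occurs_iff)

lemma determined_iff:
  assumes "determined A I E" "x \<in> Omega A" "y \<in> Omega A" "\<And>i. i \<in> I \<Longrightarrow> x i = y i"
  shows "x \<in> E \<longleftrightarrow> y \<in> E"
  using assms unfolding determined_def by metis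

text \<open>Concatenation of two words. It shows that the length of a word is a period, so that the minimum defining
\<open>period\<close> is at most this length.\<close>

lemma initial_cyl_shift_meets:
  assumes "\<omega> \<in> Omega A" "\<eta> \<in> Omega A"
  shows "initial_cyl A \<omega> n \<inter> (shift ^^ n) -` initial_cyl A \<eta> m \<noteq> {}"
proof -
  have "(\<lambda>i. if i < n then \<omega> i else \<eta> (i - n)) \<in> initial_cyl A \<omega> n \<inter> (shift ^^ n) -` initial_cyl A \<eta> m"
    using assms by (auto simp: initial_cyl_iff shift_funpow Omega_iff)
  then show ?thesis by blast
qed

lemma period_le:
  assumes "1 \<le> k" "k \<le> n" "initial_cyl A \<omega> n \<inter> (shift ^^ k) -` initial_cyl A \<omega> n \<noteq> {}"
  shows "period n (initial_cyl A \<omega> n) \<le> k"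
  unfolding period_def using assms by (intro Min_le) auto

lemma cross_period_le:
  assumes "k \<le> min n m" "initial_cyl A \<omega> n \<inter> (shift ^^ k) -` initial_cyl A \<eta> m \<noteq> {}
      \<or> initial_cyl A \<eta> m \<inter> (shift ^^ k) -` initial_cyl A \<omega> n \<noteq> {}"
  shows "cross_period n m (initial_cyl A \<omega> n) (initial_cyl A \<eta> m) \<le> k"
  unfolding cross_period_def using assms by (intro Min_le) auto

lemma kappa_le:
  shows "kappa A \<omega> \<eta> n m \<le> cross_period n m (initial_cyl A \<omega> n) (initial_cyl A \<eta> m)"
    and "kappa A \<omega> \<eta> n m \<le> period n (initial_cyl A \<omega> n)"
    and "kappa A \<omega> \<eta> n m \<le> period m (initial_cyl A \<eta> m)"
  unfolding kappa_def by (auto intro!: Min_le)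

lemma kappa_le_length:
  assumes "\<omega> \<in> Omega A" "\<eta> \<in> Omega A" "1 \<le> n" "1 \<le> m"
  shows "kappa A \<omega> \<eta> n m \<le> n" "kappa A \<omega> \<eta> n m \<le> m"
  using kappa_le[of A \<omega> \<eta> n m] period_le[OF assms(3) le_refl initial_cyl_shift_meets[OF assms(1) assms(1)]]
    period_le[OF assms(4) le_refl initial_cyl_shift_meets[OF assms(2) assms(2)]]
  by linarith+

text \<open>If one of the two words starts \<open>d\<close> places after the other in a common sequence, then \<open>\<kappa>\<close> bounds the number of
letters of the earlier word that precede the later one. A shift \<open>d \<le> min n m\<close> is a candidate in the minimum that
defines the relevant period; for larger \<open>d\<close> the bound holds because \<open>\<kappa>\<close> is at most the length of either word.
The shift \<open>d = 0\<close> carries information only for two different words.\<close>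

lemma kappa_le_overlap:
  assumes mem: "\<omega> \<in> Omega A" "\<eta> \<in> Omega A" "1 \<le> n" "1 \<le> m"
    and words: "(\<zeta>, p) \<in> {(\<omega>, n), (\<eta>, m)}" "(\<zeta>', p') \<in> {(\<omega>, n), (\<eta>, m)}"
    and d: "1 \<le> d \<or> (\<zeta>, p) = (\<omega>, n) \<and> (\<zeta>', p') = (\<eta>, m)"
    and y: "y \<in> initial_cyl A \<zeta> p" "(shift ^^ d) y \<in> initial_cyl A \<zeta>' p'"
  shows "kappa A \<omega> \<eta> n m \<le> min d p"
proof -
  have p: "kappa A \<omega> \<eta> n m \<le> p"
    using words(1) kappa_le_length[OF mem] by auto
  have ne: "initial_cyl A \<zeta> p \<inter> (shift ^^ d) -` initial_cyl A \<zeta>' p' \<noteq> {}"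
    using y by auto
  have "kappa A \<omega> \<eta> n m \<le> d"
  proof (cases "d \<le> min n m")
    case True
    have "kappa A \<omega> \<eta> n m \<le> d" if "\<zeta> = \<omega>" "p = n" "\<zeta>' = \<omega>" "p' = n" "1 \<le> d"
      using kappa_le(2)[of A \<omega> \<eta> n m] period_le[of d n A \<omega>] ne that True by auto
    moreover have "kappa A \<omega> \<eta> n m \<le> d" if "\<zeta> = \<eta>" "p = m" "\<zeta>' = \<eta>" "p' = m" "1 \<le> d"
      using kappa_le(3)[of A \<omega> \<eta> n m] period_le[of d m A \<eta>] ne that True by auto
    moreover have "kappa A \<omega> \<eta> n m \<le> d" if "\<zeta> = \<omega>" "p = n" "\<zeta>' = \<eta>" "p' = m"
      using kappa_le(1)[of A \<omega> \<eta> n m] cross_period_le[of d n m A \<omega> \<eta>] ne that True by auto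
    moreover have "kappa A \<omega> \<eta> n m \<le> d" if "\<zeta> = \<eta>" "p = m" "\<zeta>' = \<omega>" "p' = n"
      using kappa_le(1)[of A \<omega> \<eta> n m] cross_period_le[of d n m A \<omega> \<eta>] ne that True by auto
    ultimately show ?thesis using words d by auto
  next
    case False
    then show ?thesis using kappa_le_length[OF mem] by auto
  qed
  with p show ?thesis by simp
qed

context shift_system
begin

lemma occurs_events: "occurs A \<omega> n s \<in> events"
  by (rule determined_events[OF _ determined_occurs]) auto

lemma shift_measurable: "shift \<in> P \<rightarrow>\<^sub>M P"
proof -
  have "shift \<in> seq_space A \<rightarrow>\<^sub>M seq_space A"
    unfolding seq_space_def shift_def[abs_def]
    by (rule measurable_PiM_single') (auto simp: space_PiM PiE_iff)
  then show ?thesis by (simp add: measurable_cong_sets[OF sets_P sets_P])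
qed

lemma distr_shift_funpow: "distr P P (shift ^^ s) = P"
proof (induction s)
  case 0
  then show ?case using distr_id[of P] by (simp add: id_def)
next
  case (Suc s)
  have "(shift ^^ s) \<in> P \<rightarrow>\<^sub>M P" using shift_measurable by (rule measurable_compose_n)
  then have "distr P P (shift ^^ Suc s) = distr (distr P P (shift ^^ s)) P shift"
    using shift_measurable by (subst distr_distr) auto
  then show ?case using Suc invariant by (simp add: comp_def)
qed

lemma prob_occurs: "prob (occurs A \<omega> n s) = prob (initial_cyl A \<omega> n)"
proof -
  have ev: "initial_cyl A \<omega> n \<in> events"
  proof -
    have "occurs A \<omega> n 0 = initial_cyl A \<omega> n" by (auto simp: occurs_def initial_cyl_iff)
    then show ?thesis using occurs_events[of \<omega> n 0] by simp
  qed
  have "(shift ^^ s) \<in> P \<rightarrow>\<^sub>M P" using shift_measurable by (rule measurable_compose_n)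
  then have "measure (distr P P (shift ^^ s)) (initial_cyl A \<omega> n) = prob ((shift ^^ s) -` initial_cyl A \<omega> n \<inter> space P)"
    using ev by (rule measure_distr)
  moreover have "(shift ^^ s) -` initial_cyl A \<omega> n \<inter> space P = occurs A \<omega> n s"
    by (auto simp: occurs_def space_P)
  ultimately show ?thesis by (simp add: distr_shift_funpow)
qed

lemma determined_profile:
  assumes "\<And>j. j \<in> J \<Longrightarrow> determined A (I j) (X j)" "\<And>j. j \<in> J \<Longrightarrow> determined A (I j) (Y j)"
  shows "determined A (\<Union>j\<in>J. I j) (profile X Y J U W)"
  unfolding determined_def
proof (intro conjI ballI impI)
  fix x y assume x: "x \<in> profile X Y J U W" and y: "y \<in> Omega A" and eq: "\<forall>i\<in>\<Union>(I ` J). x i = y i"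
  have xO: "x \<in> Omega A" using x by (simp add: profile_def space_P)
  have X: "x \<in> X j \<longleftrightarrow> y \<in> X j" if "j \<in> J" for j
    by (rule determined_iff[OF assms(1)[OF that] xO y]) (use eq that in blast)
  have Y: "x \<in> Y j \<longleftrightarrow> y \<in> Y j" if "j \<in> J" for j
    by (rule determined_iff[OF assms(2)[OF that] xO y]) (use eq that in blast)
  have "{j \<in> J. y \<in> X j} = {j \<in> J. x \<in> X j}" "{j \<in> J. y \<in> Y j} = {j \<in> J. x \<in> Y j}"
    using X Y by auto
  with x y show "y \<in> profile X Y J U W" by (simp add: profile_def space_P)
qed (auto simp: profile_def space_P)

end

section \<open>Simultaneous visits along several time scales\<close>

text \<open>Here \<open>N\<close> bounds the lengths of the words and \<open>g0\<close> is an index from which on the \<open>l\<close> positions \<open>q i k\<close> of one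
step are \<open>2 * N\<close> apart, which leaves gaps of length at least \<open>N\<close> between words at these positions.\<close>

locale multiple_visits = shift_system +
  fixes l :: nat and q :: "nat \<Rightarrow> nat \<Rightarrow> nat" and N g0 :: nat
  assumes l: "1 \<le> l"
    and q_strict: "\<And>i. i \<in> {1..l} \<Longrightarrow> strict_mono (q i)"
    and q_index: "\<And>i k. i \<in> {1..<l} \<Longrightarrow> q i k < q (Suc i) k"
    and q_spread: "\<And>i k. g0 \<le> k \<Longrightarrow> i \<in> {1..<l} \<Longrightarrow> q i k + 2 * N \<le> q (Suc i) k"
begin

definition visit :: "(nat \<Rightarrow> 'a) \<Rightarrow> nat \<Rightarrow> nat \<Rightarrow> (nat \<Rightarrow> 'a) set" where
  "visit \<omega> n k = {x \<in> Omega A. \<forall>i\<in>{1..l}. x \<in> occurs A \<omega> n (q i k)}"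

text \<open>The indices \<open>j\<close> one of whose positions comes within \<open>2 * N\<close> of a position of step \<open>k\<close>. All \<open>l * l\<close> pairs of
scales matter: for instance, the position of \<open>j\<close> on a fast scale may meet that of a much larger \<open>k\<close> on a slow one.\<close>

definition near :: "nat \<Rightarrow> nat set" where
  "near k = {j. \<exists>i\<in>{1..l}. \<exists>i'\<in>{1..l}. q i' j < q i k + 2 * N \<and> q i k < q i' j + 2 * N}"

lemma q_first_le: "i \<in> {1..l} \<Longrightarrow> q 1 k \<le> q i k"
proof (induction i)
  case (Suc i)
  show ?case
  proof (cases "i = 0")
    case False
    then have "q 1 k \<le> q i k" using Suc by auto
    also have "\<dots> < q (Suc i) k" using Suc False by (intro q_index) auto
    finally show ?thesis by simp
  qed auto
qed simp

lemma q_spread_less: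
  assumes "g0 \<le> k" "1 \<le> i" "i' \<le> l" "i < i'"
  shows "q i k + 2 * N \<le> q i' k"
proof -
  have "Suc i \<le> i'" using assms by simp
  then show ?thesis using assms(3)
  proof (induction i' rule: dec_induct)
    case base
    then show ?case using assms by (intro q_spread) auto
  next
    case (step j)
    then have "q j k < q (Suc j) k" using assms by (intro q_index) auto
    with step show ?case by simp
  qed
qed

lemma determined_visit: "determined A (\<Union>i\<in>{1..l}. {q i k..<q i k + n}) (visit \<omega> n k)"
  unfolding visit_def by (intro determined_INT determined_occurs)

lemma visit_events: "visit \<omega> n k \<in> events"
  by (rule determined_events[OF _ determined_visit]) auto

lemma prob_visit_le: "prob (visit \<omega> n k) \<le> prob (initial_cyl A \<omega> n)"
  unfolding prob_occurs[symmetric, of \<omega> n "q 1 k"]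
  using l by (intro finite_measure_mono occurs_events) (auto simp: visit_def)

text \<open>For each pair of scales, strict monotonicity of \<open>q i'\<close> maps the near indices injectively into an interval of
length \<open>4 * N\<close>.\<close>

lemma near_bound: "finite (near k)" "card (near k) \<le> l * l * (4 * N)"
proof -
  define T where "T i i' = {j. q i' j < q i k + 2 * N \<and> q i k < q i' j + 2 * N}" for i i'
  have T: "finite (T i i') \<and> card (T i i') \<le> 4 * N" if "i' \<in> {1..l}" for i i'
  proof -
    have inj: "inj_on (q i') (T i i')"
      using strict_mono_imp_inj_on[OF q_strict[OF that]] by (rule inj_on_subset) (rule subset_UNIV)
    have sub: "q i' ` T i i' \<subseteq> {q i k + 1 - 2 * N..<q i k + 2 * N}"
      by (auto simp: T_def)
    have "card (T i i') = card (q i' ` T i i')" by (rule card_image[OF inj, symmetric])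
    also have "\<dots> \<le> card {q i k + 1 - 2 * N..<q i k + 2 * N}" by (rule card_mono[OF _ sub]) simp
    also have "\<dots> \<le> 4 * N" by simp
    finally show ?thesis using finite_imageD[OF finite_subset[OF sub] inj] by simp
  qed
  have near_eq: "near k = (\<Union>(i, i')\<in>{1..l} \<times> {1..l}. T i i')"
    by (auto simp: near_def T_def)
  show "finite (near k)" unfolding near_eq using T by auto
  have "card (near k) \<le> (\<Sum>(i, i')\<in>{1..l} \<times> {1..l}. card (T i i'))"
    unfolding near_eq case_prod_unfold by (rule card_UN_le) simp
  also have "\<dots> \<le> (\<Sum>c\<in>{1..l} \<times> {1..l}. 4 * N)"
    using T by (intro sum_mono) auto
  also have "\<dots> = l * l * (4 * N)" by simp
  finally show "card (near k) \<le> l * l * (4 * N)" .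
qed

text \<open>The positions of one step are \<open>2 * N\<close> apart and a word at a position fills at most \<open>N\<close> places, so \<open>N \<ge> g\<close> free
places remain up to the next position; \<open>far\<close> asks for the same distance from the coordinates of \<open>E\<close>.\<close>

lemma decouple_visit:
  assumes fin: "psi A P g < \<infinity>" and u: "enn2real (psi A P g) \<le> 1 / 4"
    and n: "1 \<le> n" "n \<le> N" "g \<le> N" and k: "g0 \<le> k"
    and I: "finite I" "determined A I E"
    and far: "\<And>c i. c \<in> I \<Longrightarrow> i \<in> {1..l} \<Longrightarrow> c + N \<le> q i k \<or> q i k + 2 * N \<le> c"
  shows "\<bar>prob (visit \<omega> n k \<inter> E) - prob (initial_cyl A \<omega> n) ^ l * prob E\<bar>
    \<le> ((1 + 5 * enn2real (psi A P g)) ^ l - 1) * (prob (initial_cyl A \<omega> n) ^ l * prob E)"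
proof -
  have "\<bar>prob ({x \<in> Omega A. \<forall>i\<in>{1..l}. x \<in> occurs A \<omega> n (q i k)} \<inter> E)
        - prob (initial_cyl A \<omega> n) ^ card {1..l} * prob E\<bar>
    \<le> ((1 + 5 * enn2real (psi A P g)) ^ card {1..l} - 1) * (prob (initial_cyl A \<omega> n) ^ card {1..l} * prob E)"
  proof (rule decouple_windows[OF fin u _ _ I, where J = "\<lambda>i. {q i k..<q i k + n}"])
    fix c i assume "i \<in> {1..l}" "c \<in> I"
    then show "(\<forall>j\<in>{q i k..<q i k + n}. c + g \<le> j) \<or> (\<forall>j\<in>{q i k..<q i k + n}. j + g \<le> c)"
      using far[of c i] n by auto
  next
    fix i i' c assume i: "i \<in> {1..l}" "i' \<in> {1..l}" "i \<noteq> i'" and c: "c \<in> {q i' k..<q i' k + n}"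
    show "(\<forall>j\<in>{q i k..<q i k + n}. c + g \<le> j) \<or> (\<forall>j\<in>{q i k..<q i k + n}. j + g \<le> c)"
      using q_spread_less[OF k, of i i'] q_spread_less[OF k, of i' i] i c n
      by (cases "i < i'") auto
  qed (use n in \<open>auto simp: determined_occurs prob_occurs\<close>)
  then show ?thesis by (simp add: visit_def)
qed

lemma decouple_visit_profile:
  assumes fin: "psi A P g < \<infinity>" and u: "enn2real (psi A P g) \<le> 1 / 4"
    and n: "1 \<le> n" "n \<le> N" "g \<le> N" and k: "g0 \<le> k"
    and XY: "\<And>j. determined A (\<Union>i\<in>{1..l}. {q i j..<q i j + N}) (X j)"
      "\<And>j. determined A (\<Union>i\<in>{1..l}. {q i j..<q i j + N}) (Y j)"
  shows "\<bar>prob (visit \<omega> n k \<inter> profile X Y ({..<k} - near k) U W)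
        - prob (initial_cyl A \<omega> n) ^ l * prob (profile X Y ({..<k} - near k) U W)\<bar>
    \<le> ((1 + 5 * enn2real (psi A P g)) ^ l - 1)
        * (prob (initial_cyl A \<omega> n) ^ l * prob (profile X Y ({..<k} - near k) U W))"
proof (rule decouple_visit[OF fin u n k _ determined_profile[OF XY]])
  fix c i assume "c \<in> (\<Union>j\<in>{..<k} - near k. \<Union>i\<in>{1..l}. {q i j..<q i j + N})" and i: "i \<in> {1..l}"
  then obtain j i' where "j \<notin> near k" "i' \<in> {1..l}" "c \<in> {q i' j..<q i' j + N}" by blast
  moreover from this i have "\<not> (q i' j < q i k + 2 * N \<and> q i k < q i' j + 2 * N)"
    unfolding near_def by blast
  ultimately show "c + N \<le> q i k \<or> q i k + 2 * N \<le> c" by auto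
qed auto

text \<open>Two visits at times \<open>j < k\<close> are compared on the first scale only. There the visit at \<open>j\<close> starts strictly before every
position of the visit at \<open>k\<close>, so it contributes a prefix of length \<open>min d p \<ge> \<kappa>\<close> that lies to the left of all of
them. Mixing with gap 1 separates this prefix, which has probability at most \<open>exp (- \<upsilon> * \<kappa>)\<close>. Nothing is asked
about how the other positions of \<open>j\<close> and \<open>k\<close> interlace.\<close>

lemma overlap_visit:
  assumes fin: "psi A P 1 < \<infinity>" and jk: "j < k" and p: "1 \<le> p" and \<zeta>: "\<zeta> \<in> Omega A"
    and \<upsilon>: "0 < \<upsilon>" and decay: "\<And>n E. 1 \<le> n \<Longrightarrow> E \<in> cylinders A n \<Longrightarrow> prob E \<le> exp (- \<upsilon> * real n)"
    and \<kappa>: "\<And>d y. 1 \<le> d \<Longrightarrow> y \<in> initial_cyl A \<zeta> p \<Longrightarrow> (shift ^^ d) y \<in> initial_cyl A \<omega> n \<Longrightarrow> \<kappa> \<le> min d p"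
  shows "prob (visit \<omega> n k \<inter> visit \<zeta> p j) \<le> (1 + enn2real (psi A P 1)) * exp (- \<upsilon> * real \<kappa>) * prob (visit \<omega> n k)"
proof (cases "visit \<omega> n k \<inter> visit \<zeta> p j = {}")
  case True
  then show ?thesis by simp
next
  case False
  then obtain x where x: "x \<in> visit \<omega> n k" "x \<in> visit \<zeta> p j" by blast
  have l1: "1 \<in> {1..l}" using l by simp
  have less: "q 1 j < q 1 k" using q_strict[OF l1] jk by (simp add: strict_mono_less)
  define d where "d = q 1 k - q 1 j"
  define d' where "d' = min d p"
  have d: "1 \<le> d" "1 \<le> d'" using less p by (auto simp: d_def d'_def)
  have xs: "(shift ^^ q 1 j) x \<in> initial_cyl A \<zeta> p" "(shift ^^ q 1 k) x \<in> initial_cyl A \<omega> n"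
    using x l1 by (auto simp: visit_def occurs_def)
  have "(shift ^^ d) ((shift ^^ q 1 j) x) = (shift ^^ q 1 k) x"
    using less by (simp add: d_def funpow_add[THEN fun_cong, unfolded comp_def, symmetric])
  then have le: "\<kappa> \<le> d'" unfolding d'_def using \<kappa>[OF d(1) xs(1)] xs(2) by simp
  let ?F = "occurs A \<zeta> d' (q 1 j)"
  have "prob ?F \<le> exp (- \<upsilon> * real d')" unfolding prob_occurs by (rule decay[OF d(2) initial_cyl_cylinders[OF \<zeta>]])
  also have "\<dots> \<le> exp (- \<upsilon> * real \<kappa>)" using \<upsilon> le by simp
  finally have F: "prob ?F \<le> exp (- \<upsilon> * real \<kappa>)" .
  have "prob (visit \<omega> n k \<inter> visit \<zeta> p j) \<le> prob (?F \<inter> visit \<omega> n k)"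
    using l1 by (intro finite_measure_mono sets.Int occurs_events visit_events)
      (auto simp: visit_def occurs_iff d'_def)
  also have "\<dots> \<le> (1 + enn2real (psi A P 1)) * (prob ?F * prob (visit \<omega> n k))"
  proof -
    have "\<bar>prob (?F \<inter> visit \<omega> n k) - prob ?F * prob (visit \<omega> n k)\<bar>
        \<le> enn2real (psi A P 1) * (prob ?F * prob (visit \<omega> n k))"
    proof (rule psi_mixing_determined[OF fin _ determined_occurs _ determined_visit])
      fix a b assume a: "a \<in> {q 1 j..<q 1 j + d'}" and "b \<in> (\<Union>i\<in>{1..l}. {q i k..<q i k + n})"
      then obtain i where "i \<in> {1..l}" "q i k \<le> b" by auto
      with q_first_le[of i k] have "q 1 k \<le> b" by simp
      moreover have "q 1 j + d' \<le> q 1 k" using less by (auto simp: d_def d'_def)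
      ultimately show "a + 1 \<le> b" using a by auto
    qed auto
    then show ?thesis by (simp add: abs_le_iff algebra_simps)
  qed
  also have "\<dots> \<le> (1 + enn2real (psi A P 1)) * (exp (- \<upsilon> * real \<kappa>) * prob (visit \<omega> n k))"
    using F by (intro mult_left_mono mult_right_mono) auto
  finally show ?thesis by (simp add: mult.assoc)
qed

end

section \<open>The error bound for the number of visits\<close>

lemma power_one_plus_le:
  fixes u :: real
  assumes "0 \<le> u" "u \<le> 2"
  shows "(1 + u) ^ l - 1 \<le> 4 ^ l * u"
proof (induction l)
  case (Suc l)
  have "(1 + u) ^ Suc l - 1 = (1 + u) * ((1 + u) ^ l - 1) + u" by (simp add: algebra_simps)
  also have "\<dots> \<le> 3 * (4 ^ l * u) + 1 * u"
    using Suc assms by (intro add_mono mult_mono) auto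
  also have "\<dots> \<le> 3 * (4 ^ l * u) + 4 ^ l * u"
    using assms by (intro add_left_mono mult_right_mono) auto
  finally show ?case by (simp add: algebra_simps)
qed (use assms in simp)

text \<open>The choice of the time horizon. Stopping after \<open>t\<close> steps leaves a survival probability of order \<open>1 / (\<beta> * t)\<close>, while
the accumulated errors are of order \<open>t * (\<alpha> + \<beta>) * (N * s\<^sup>2 + w\<^sup>2)\<close>, where \<open>s\<^sup>2 = exp (- \<upsilon> * \<kappa>)\<close> and \<open>w\<^sup>2\<close> is the
mixing coefficient. Taking \<open>t\<close> about \<open>1 / (\<beta> * (s + w))\<close> balances the two, since \<open>s\<^sup>2 / (s + w) \<le> s\<close> and
\<open>w\<^sup>2 / (s + w) \<le> w\<close>. This is where the square roots in the final estimate come from.\<close>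

lemma optimal_horizon:
  fixes s w \<alpha> \<beta> K L N \<gamma> :: real
  assumes s: "0 < s" "s \<le> 1" and w: "0 \<le> w" "w \<le> 1" and \<beta>: "0 < \<beta>" "\<beta> \<le> 1" and \<alpha>: "0 < \<alpha>"
    and N: "1 \<le> N" and KL: "0 \<le> K" "0 \<le> L" and \<gamma>: "0 \<le> \<gamma>"
  defines "t \<equiv> nat \<lceil>1 / (\<beta> * (s + w))\<rceil>"
  shows "0 < t"
    and "2 / (\<beta> * real t) + 2 * (K * N * s\<^sup>2) + 2 * (\<gamma> + 1) * s\<^sup>2
        + real t * (\<alpha> + \<beta>) * (2 * (K * N * s\<^sup>2) + L * w\<^sup>2)
      \<le> (6 + 8 * K + 3 * L) * (s * \<gamma> + (1 + \<alpha> / \<beta>) * (N * s + w))"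
proof -
  define \<epsilon> where "\<epsilon> = s + w"
  have \<epsilon>: "0 < \<epsilon>" "\<epsilon> \<le> 2" "s \<le> \<epsilon>" "w \<le> \<epsilon>" using s w by (auto simp: \<epsilon>_def)
  have pos: "0 < \<beta> * \<epsilon>" using \<beta> \<epsilon> by simp
  have "\<beta> * \<epsilon> \<le> 1 * 2" using \<beta> \<epsilon> by (intro mult_mono) auto
  then have "1 \<le> 2 / (\<beta> * \<epsilon>)" using pos by simp
  moreover have "-1 < 1 / (\<beta> * \<epsilon>)" using pos by (intro less_trans[OF _ divide_pos_pos]) auto
  then have "real t = real_of_int \<lceil>1 / (\<beta> * \<epsilon>)\<rceil>"
    unfolding t_def \<epsilon>_def[symmetric] by (subst of_nat_nat) auto
  ultimately have t: "1 / (\<beta> * \<epsilon>) \<le> real t" "real t \<le> 3 / (\<beta> * \<epsilon>)"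
    by linarith+
  have "0 < 1 / (\<beta> * \<epsilon>)" using pos by simp
  with t(1) have "0 < real t" by linarith
  then show t0: "0 < t" by simp
  have sq: "s\<^sup>2 \<le> s" using s by (simp add: power2_eq_square mult_left_le)
  have sq_div: "s\<^sup>2 / \<epsilon> \<le> s" "w\<^sup>2 / \<epsilon> \<le> w"
    using \<epsilon> s w by (simp_all add: pos_divide_le_eq power2_eq_square mult_left_mono)
  define r where "r = 1 + \<alpha> / \<beta>"
  have r: "1 \<le> r" using \<alpha> \<beta> by (simp add: r_def)
  have Ns: "0 \<le> N * s" "s \<le> N * s" using N s by auto
  have 1: "2 / (\<beta> * real t) \<le> 2 * (s + w)"
  proof -
    have "1 \<le> real t * (\<beta> * \<epsilon>)" using t(1) pos by (simp add: pos_divide_le_eq)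
    then have "2 \<le> 2 * \<epsilon> * (\<beta> * real t)" by (simp add: mult_ac)
    then show ?thesis using \<beta> t0 unfolding \<epsilon>_def[symmetric] by (subst pos_divide_le_eq) auto
  qed
  have 2: "2 * (K * N * s\<^sup>2) \<le> 2 * K * (N * s)"
  proof -
    have "K * N * s\<^sup>2 \<le> K * N * s" using KL N sq by (intro mult_left_mono) auto
    then show ?thesis by simp
  qed
  have 3: "2 * (\<gamma> + 1) * s\<^sup>2 \<le> 2 * (s * \<gamma>) + 2 * (N * s)"
  proof -
    have "2 * (\<gamma> + 1) * s\<^sup>2 \<le> 2 * (\<gamma> + 1) * s" using \<gamma> sq by (intro mult_left_mono) auto
    also have "\<dots> = 2 * (s * \<gamma>) + 2 * s" by (simp add: algebra_simps)
    finally show ?thesis using Ns by linarith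
  qed
  have 4: "real t * (\<alpha> + \<beta>) * (2 * (K * N * s\<^sup>2) + L * w\<^sup>2) \<le> r * (6 * K * (N * s) + 3 * L * w)"
  proof -
    have "real t * (\<alpha> + \<beta>) * (2 * (K * N * s\<^sup>2) + L * w\<^sup>2)
        \<le> 3 / (\<beta> * \<epsilon>) * (\<alpha> + \<beta>) * (2 * (K * N * s\<^sup>2) + L * w\<^sup>2)"
      using t(2) \<alpha> \<beta> KL N by (intro mult_right_mono) auto
    also have "\<dots> = r * (6 * K * N * (s\<^sup>2 / \<epsilon>) + 3 * L * (w\<^sup>2 / \<epsilon>))"
      using \<beta> \<epsilon> by (simp add: r_def field_simps)
    also have "\<dots> \<le> r * (6 * K * N * s + 3 * L * w)"
      using r KL N by (intro mult_left_mono add_mono sq_div) auto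
    finally show ?thesis by (simp add: mult.assoc)
  qed
  have rN: "N * s \<le> r * (N * s)" "w \<le> r * w" "0 \<le> r * (N * s)" "0 \<le> r * w"
    using r Ns w by (auto simp: mult_le_cancel_right1)
  have KN: "2 * K * (N * s) \<le> 2 * K * (r * (N * s))"
    using rN KL by (intro mult_left_mono) auto
  have "2 / (\<beta> * real t) + 2 * (K * N * s\<^sup>2) + 2 * (\<gamma> + 1) * s\<^sup>2
        + real t * (\<alpha> + \<beta>) * (2 * (K * N * s\<^sup>2) + L * w\<^sup>2)
      \<le> 2 * (s * \<gamma>) + (4 + 8 * K) * (r * (N * s)) + (2 + 3 * L) * (r * w)"
    using 1 2 3 4 rN KN Ns by (simp add: algebra_simps)
  also have "\<dots> \<le> (6 + 8 * K + 3 * L) * (s * \<gamma>) + (6 + 8 * K + 3 * L) * (r * (N * s)) + (6 + 8 * K + 3 * L) * (r * w)"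
  proof (rule add_mono[OF add_mono])
    show "2 * (s * \<gamma>) \<le> (6 + 8 * K + 3 * L) * (s * \<gamma>)"
      using KL s \<gamma> by (intro mult_right_mono) auto
    show "(4 + 8 * K) * (r * (N * s)) \<le> (6 + 8 * K + 3 * L) * (r * (N * s))"
      using KL rN by (intro mult_right_mono) auto
    show "(2 + 3 * L) * (r * w) \<le> (6 + 8 * K + 3 * L) * (r * w)"
      using KL rN by (intro mult_right_mono) auto
  qed
  also have "\<dots> = (6 + 8 * K + 3 * L) * (s * \<gamma> + (1 + \<alpha> / \<beta>) * (N * s + w))"
    unfolding r_def[symmetric] by (simp add: algebra_simps)
  finally show "2 / (\<beta> * real t) + 2 * (K * N * s\<^sup>2) + 2 * (\<gamma> + 1) * s\<^sup>2
        + real t * (\<alpha> + \<beta>) * (2 * (K * N * s\<^sup>2) + L * w\<^sup>2)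
      \<le> (6 + 8 * K + 3 * L) * (s * \<gamma> + (1 + \<alpha> / \<beta>) * (N * s + w))" .
qed

lemma gap_index_spread:
  assumes lim: "qgap l q \<longlonglongrightarrow> \<infinity>" and lt: "\<forall>n. \<forall>i\<in>{1..<l}. q i n < q (Suc i) n"
    and k: "gap_index l q n \<le> k" and i: "i \<in> {1..<l}"
  shows "q i k + 2 * n \<le> q (Suc i) k"
proof -
  have "eventually (\<lambda>k. enat (2 * n) < qgap l q k) sequentially"
    using lim by (rule order_tendstoD(1)) simp
  then obtain k0 where "enat (2 * n) < qgap l q k0"
    unfolding eventually_sequentially by blast
  then have "enat (2 * n) \<le> qgap l q k0" by simp
  then have "enat (2 * n) \<le> qgap l q (gap_index l q n)"
    unfolding gap_index_def by (rule LeastI)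
  also have "\<dots> \<le> enat (q (Suc i) k - q i k)"
    unfolding qgap_def using k i by (intro INF_lower2[of k] INF_lower) auto
  finally have "2 * n \<le> q (Suc i) k - q i k" by simp
  moreover have "q i k < q (Suc i) k" using lt i by blast
  ultimately show ?thesis by linarith
qed

lemma enat_eq_by_less:
  assumes "\<And>r. enat r < a \<longleftrightarrow> enat r < b"
  shows "a = b"
proof (rule ccontr)
  assume "a \<noteq> b"
  then consider "a < b" | "b < a" by (rule linorder_neqE)
  then show False
  proof cases
    case 1
    then obtain r where "a = enat r" by (cases a) auto
    with 1 assms[of r] show False by simp
  next
    case 2
    then obtain r where "b = enat r" by (cases b) auto
    with 2 assms[of r] show False by simp
  qed
qed

context multiple_visits
begin

text \<open>The time \<open>\<tau>\<close> is at least 1, so a visit at index 0 must not stop the count.\<close>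

definition hazard :: "(nat \<Rightarrow> 'a) \<Rightarrow> nat \<Rightarrow> nat \<Rightarrow> (nat \<Rightarrow> 'a) set" where
  "hazard \<eta> m k = (if k = 0 then {} else visit \<eta> m k)"

lemma hazard_events: "hazard \<eta> m k \<in> events"
  by (simp add: hazard_def visit_events)

lemma determined_hazard: "determined A (\<Union>i\<in>{1..l}. {q i k..<q i k + m}) (hazard \<eta> m k)"
  using determined_visit by (simp add: hazard_def) (simp add: determined_def)

lemma less_tau_iff:
  assumes "x \<in> Omega A"
  shows "enat k < tau A l q \<eta> m x \<longleftrightarrow> (\<forall>j\<le>k. x \<notin> hazard \<eta> m j)"
proof -
  let ?K = "{enat j | j. x \<in> hazard \<eta> m j}"
  have hz: "x \<in> hazard \<eta> m j \<longleftrightarrow> 1 \<le> j \<and> (\<forall>i\<in>{1..l}. (shift ^^ q i j) x \<in> initial_cyl A \<eta> m)" for j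
    using assms by (auto simp: hazard_def visit_def occurs_def)
  have "tau A l q \<eta> m x = Inf ?K" unfolding tau_def hz ..
  moreover have "enat k < Inf ?K \<longleftrightarrow> enat (Suc k) \<le> Inf ?K"
    using Suc_ile_eq by blast
  moreover have "enat (Suc k) \<le> Inf ?K \<longleftrightarrow> (\<forall>j. x \<in> hazard \<eta> m j \<longrightarrow> Suc k \<le> j)"
    unfolding le_Inf_iff by auto
  ultimately show ?thesis by (metis not_less_eq_eq)
qed

lemma Sigma_count_eq:
  assumes "x \<in> Omega A"
  shows "Sigma_count A l q \<omega> \<eta> n m x
    = (\<Sum>k. if x \<in> visit \<omega> n k \<and> (\<forall>j\<le>k. x \<notin> hazard \<eta> m j) then 1 else 0)"
proof -
  have "(\<Prod>i\<in>{1..l}. indicator (initial_cyl A \<omega> n) ((shift ^^ q i k) x))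
      = (if x \<in> visit \<omega> n k then 1 else 0 :: enat)" for k
  proof (cases "x \<in> visit \<omega> n k")
    case True
    then show ?thesis by (auto simp: visit_def occurs_def intro!: prod.neutral)
  next
    case False
    then obtain i where "i \<in> {1..l}" "(shift ^^ q i k) x \<notin> initial_cyl A \<omega> n"
      using assms by (auto simp: visit_def occurs_def)
    then have "(\<Prod>i\<in>{1..l}. indicator (initial_cyl A \<omega> n) ((shift ^^ q i k) x)) = (0 :: enat)"
      by (intro prod_zero bexI[of _ i]) (simp_all add: indicator_def)
    with False show ?thesis by simp
  qed
  then show ?thesis
    unfolding Sigma_count_def less_tau_iff[OF assms] by (intro arg_cong[where f = suminf]) auto
qed

lemma Sigma_count_at_hazard:
  assumes x: "x \<in> Omega A" "x \<in> hazard \<eta> m k" "\<And>j. j < k \<Longrightarrow> x \<notin> hazard \<eta> m j"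
  shows "Sigma_count A l q \<omega> \<eta> n m x = enat (card {j \<in> {..<k}. x \<in> visit \<omega> n j})"
proof -
  have "Sigma_count A l q \<omega> \<eta> n m x = (\<Sum>j. if j \<in> {j \<in> {..<k}. x \<in> visit \<omega> n j} then 1 else 0)"
    unfolding Sigma_count_eq[OF x(1)] using x
    by (intro arg_cong[where f = suminf] ext if_cong) (auto simp: not_le[symmetric])
  also have "\<dots> = (\<Sum>j\<in>{j \<in> {..<k}. x \<in> visit \<omega> n j}. 1)"
    by (subst suminf_finite[of "{j \<in> {..<k}. x \<in> visit \<omega> n j}"]) auto
  also have "\<dots> = enat (card {j \<in> {..<k}. x \<in> visit \<omega> n j})"
    by (simp add: of_nat_eq_enat)
  finally show ?thesis .
qed

text \<open>The values lie in a countable type, so it suffices to recognise \<open>Sigma_count = c\<close> from the countably many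
events \<open>r < Sigma_count\<close>, each of which is visible in a partial sum.\<close>

lemma Sigma_count_measurable: "Sigma_count A l q \<omega> \<eta> n m \<in> P \<rightarrow>\<^sub>M count_space UNIV"
proof -
  define Z where "Z k = {x \<in> space P. x \<in> visit \<omega> n k \<and> (\<forall>j\<le>k. x \<notin> hazard \<eta> m j)}" for k
  note visit_events[measurable] hazard_events[measurable]
  have Z: "Z k \<in> events" for k unfolding Z_def by measurable
  have partial: "(\<Sum>k<t. if x \<in> visit \<omega> n k \<and> (\<forall>j\<le>k. x \<notin> hazard \<eta> m j) then 1 else 0)
      = enat (card {k \<in> {..<t}. x \<in> Z k})" if "x \<in> space P" for x t
  proof -
    have "(\<Sum>k<t. if x \<in> visit \<omega> n k \<and> (\<forall>j\<le>k. x \<notin> hazard \<eta> m j) then 1 else 0 :: enat)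
        = (\<Sum>k\<in>{k \<in> {..<t}. x \<in> Z k}. 1)"
      using that by (subst sum.inter_filter) (auto simp: Z_def intro!: sum.cong)
    then show ?thesis by (simp add: of_nat_eq_enat)
  qed
  have less: "enat r < Sigma_count A l q \<omega> \<eta> n m x \<longleftrightarrow> (\<exists>t. real r < real (card {k \<in> {..<t}. x \<in> Z k}))"
    if "x \<in> space P" for r x
  proof -
    have x: "x \<in> Omega A" using that by (simp add: space_P)
    have "Sigma_count A l q \<omega> \<eta> n m x = (SUP t. enat (card {k \<in> {..<t}. x \<in> Z k}))"
      unfolding Sigma_count_eq[OF x] suminf_eq_SUP partial[OF that] ..
    then show ?thesis by (simp only: less_SUP_iff enat_ord_simps of_nat_less_iff) blast
  qed
  have meas: "(\<lambda>x. real (card {k \<in> {..<t}. x \<in> Z k})) \<in> borel_measurable P" for t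
    by (rule profile_borel[OF Z Z finite_lessThan, where F = "\<lambda>U W. real (card U)"])
  have less_ev: "{x \<in> space P. enat r < Sigma_count A l q \<omega> \<eta> n m x} \<in> events" for r
  proof -
    have "{x \<in> space P. enat r < Sigma_count A l q \<omega> \<eta> n m x}
        = {x \<in> space P. \<exists>t. real r < real (card {k \<in> {..<t}. x \<in> Z k})}"
      using less by blast
    also have "\<dots> \<in> events" using meas by measurable
    finally show ?thesis .
  qed
  have "Sigma_count A l q \<omega> \<eta> n m -` {c} \<inter> space P \<in> events" for c
  proof -
    have eq: "y = c \<longleftrightarrow> (\<forall>r. (enat r < y) = (enat r < c))" for y
      using enat_eq_by_less[of y c] by blast
    have "Sigma_count A l q \<omega> \<eta> n m -` {c} \<inter> space P
        = {x \<in> space P. Sigma_count A l q \<omega> \<eta> n m x = c}"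
      by blast
    also have "\<dots> = {x \<in> space P. \<forall>r. (enat r < Sigma_count A l q \<omega> \<eta> n m x) = (enat r < c)}"
      by (simp only: eq)
    also have "\<dots> \<in> events" using less_ev by measurable
    finally show ?thesis .
  qed
  then show ?thesis
    by (subst measurable_count_space_eq2_countable) (auto intro: countableI_type)
qed

text \<open>If \<open>\<kappa> = 0\<close>, or if the mixing coefficient is not small compared with \<open>1 / 4 ^ l\<close>, the right-hand side is at least 1 and the
estimate is trivial. Otherwise \<open>\<kappa> > 0\<close> makes marks and hazards at the same index disjoint, and
\<open>count_before_hazard_geometric\<close> applies with \<open>near\<close> as the set of dependent indices. The at most \<open>g0 + 1\<close> indices
before the scales have separated are estimated by the probability of a single word. The constant is
\<open>6 + 8 * K + 3 * L\<close>, with \<open>K\<close> collecting the overlaps and \<open>L\<close> the decoupling errors.\<close>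

lemma visits_until_hazard_geometric:
  assumes mix: "psi A P 1 < \<infinity>" "psi A P m < \<infinity>"
    and \<upsilon>: "0 < \<upsilon>" and decay: "\<And>n E. 1 \<le> n \<Longrightarrow> E \<in> cylinders A n \<Longrightarrow> prob E \<le> exp (- \<upsilon> * real n)"
    and \<omega>: "\<omega> \<in> Omega_P A P" and \<eta>: "\<eta> \<in> Omega_P A P"
    and n: "1 \<le> n" and m: "1 \<le> m" and N: "N = max n m"
  defines "s \<equiv> exp (- (1 / 2) * \<upsilon> * real (kappa A \<omega> \<eta> n m))"
    and "\<alpha> \<equiv> prob (initial_cyl A \<omega> n) ^ l"
    and "\<beta> \<equiv> prob (initial_cyl A \<eta> m) ^ l"
    and "C \<equiv> 6 + 96 * real l ^ 2 * (1 + enn2real (psi A P 1)) + 15 * 4 ^ l"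
  shows "d_TV (distr P (count_space UNIV) (Sigma_count A l q \<omega> \<eta> n m)) (Geo (\<beta> / (\<beta> + \<alpha>)))
    \<le> C * (s * real g0 + (1 + \<alpha> / \<beta>) * (real N * s + sqrt (enn2real (psi A P m))))"
proof -
  define \<psi> where "\<psi> = enn2real (psi A P m)"
  define c where "c = 1 + enn2real (psi A P 1)"
  define w where "w = sqrt \<psi>"
  define \<kappa> where "\<kappa> = kappa A \<omega> \<eta> n m"
  define e where "e = exp (- \<upsilon> * real \<kappa>)"
  define L :: real where "L = 5 * 4 ^ l"
  define K where "K = 12 * real l ^ 2 * c"
  define R where "R = s * real g0 + (1 + \<alpha> / \<beta>) * (real N * s + w)"
  let ?S = "Sigma_count A l q \<omega> \<eta> n m"
  have \<psi>: "0 \<le> \<psi>" and c: "1 \<le> c" by (auto simp: \<psi>_def c_def)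
  have "(1::real) \<le> 4 ^ l" by simp
  then have L: "1 \<le> L" unfolding L_def by linarith
  have K: "0 \<le> K" using c by (simp add: K_def)
  have C_eq: "C = 6 + 8 * K + 3 * L" by (simp add: C_def K_def L_def c_def)
  have s: "0 < s" "s \<le> 1" using \<upsilon> by (auto simp: s_def)
  have e_s: "e = s\<^sup>2" by (simp add: e_def s_def \<kappa>_def power2_eq_square exp_add[symmetric])
  have w: "0 \<le> w" "w\<^sup>2 = \<psi>" using \<psi> by (auto simp: w_def)
  have mem: "\<omega> \<in> Omega A" "\<eta> \<in> Omega A" using \<omega> \<eta> by (auto simp: Omega_P_def)
  have cyl_pos: "0 < prob (initial_cyl A \<zeta> p)" if "\<zeta> \<in> Omega_P A P" "1 \<le> p" for \<zeta> p
    using that by (cases p) (auto simp: Omega_P_def)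
  have \<alpha>: "0 < \<alpha>" and \<beta>: "0 < \<beta>" "\<beta> \<le> 1"
    unfolding \<alpha>_def \<beta>_def using cyl_pos \<omega> \<eta> n m by (auto intro: power_le_one)
  have len: "n \<le> N" "m \<le> N" "1 \<le> real N" using N n by auto
  have R: "real N * s + w \<le> R"
  proof -
    have "1 * (real N * s + w) \<le> (1 + \<alpha> / \<beta>) * (real N * s + w)"
      using \<alpha> \<beta> s w by (intro mult_right_mono) auto
    moreover have "0 \<le> s * real g0" using s by simp
    ultimately show ?thesis by (simp add: R_def)
  qed
  have S_meas: "?S \<in> P \<rightarrow>\<^sub>M count_space UNIV" by (rule Sigma_count_measurable)

  have bound: "\<bar>prob (?S -` G \<inter> space P) - measure_pmf.prob (geometric_pmf (\<beta> / (\<beta> + \<alpha>))) (enat -` G)\<bar> \<le> C * R" for G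
  proof (cases "\<kappa> = 0 \<or> 1 / 2 < L * \<psi>")
    case True
    have "1 \<le> C * R"
    proof (cases "\<kappa> = 0")
      case True
      then have "s = 1" by (simp add: s_def \<kappa>_def)
      then have "1 * 1 \<le> C * R" using R w len L K by (intro mult_mono) (auto simp: C_eq)
      then show ?thesis by simp
    next
      case False
      with \<open>\<kappa> = 0 \<or> 1 / 2 < L * \<psi>\<close> have big: "1 / 2 < L * \<psi>" by simp
      have "1 / 2 \<le> L * w"
      proof (cases "\<psi> \<le> 1")
        case True
        then have "\<psi> \<le> w" unfolding w_def using \<psi> by (intro real_le_rsqrt) (simp add: power2_eq_square mult_left_le)
        then have "L * \<psi> \<le> L * w" using L by (intro mult_left_mono) auto
        with big show ?thesis by simp
      next
        case False
        then have "1 \<le> w" by (simp add: w_def)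
        then have "1 * 1 \<le> L * w" using L by (intro mult_mono) auto
        then show ?thesis by simp
      qed
      moreover have "3 * L * w \<le> C * R"
        using R s len L K w by (intro mult_mono) (auto simp: C_eq intro: order_trans[rotated])
      ultimately show ?thesis by linarith
    qed
    moreover have "\<bar>prob (?S -` G \<inter> space P) - measure_pmf.prob (geometric_pmf (\<beta> / (\<beta> + \<alpha>))) (enat -` G)\<bar> \<le> 1"
      by (simp add: abs_le_iff add_increasing2 diff_le_eq)
    ultimately show ?thesis by linarith
  next
    case False
    define \<delta> where "\<delta> = L * \<psi>"
    have \<kappa>: "\<kappa> \<noteq> 0" and \<delta>: "0 \<le> \<delta>" "\<delta> \<le> 1 / 2" using False \<psi> L by (auto simp: \<delta>_def)
    have "20 * \<psi> \<le> L * \<psi>"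
    proof (rule mult_right_mono[OF _ \<psi>])
      have "(4::real) ^ 1 \<le> 4 ^ l" using l by (intro power_increasing) auto
      then show "20 \<le> L" by (simp add: L_def)
    qed
    then have \<psi>_small: "\<psi> \<le> 1 / 40" using \<delta> by (simp add: \<delta>_def)
    then have w1: "w \<le> 1" unfolding w_def by (simp add: real_sqrt_le_1_iff)
    have \<delta>_power: "(1 + 5 * \<psi>) ^ l - 1 \<le> \<delta>"
      using power_one_plus_le[of "5 * \<psi>" l] \<psi> \<psi>_small by (simp add: \<delta>_def L_def)
    \<comment> \<open>At most \<open>4 * N * l\<^sup>2\<close> near indices, each with a mark and a hazard, each costing a factor
      \<open>c * e\<close>, relative to a visit of probability at most \<open>3 / 2\<close> times the product: this gives
      the 12 in \<open>K\<close>.\<close>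
    define \<theta> where "\<theta> = K * real N * e"
    have \<theta>: "0 \<le> \<theta>" using K by (simp add: \<theta>_def e_def)
    let ?X = "visit \<omega> n" and ?Y = "hazard \<eta> m"
    define g where "g = max g0 1"
    have dec: "\<bar>prob (visit \<zeta> p k \<inter> profile ?X ?Y ({..<k} - near k) U W)
        - prob (initial_cyl A \<zeta> p) ^ l * prob (profile ?X ?Y ({..<k} - near k) U W)\<bar>
      \<le> \<delta> * prob (initial_cyl A \<zeta> p) ^ l * prob (profile ?X ?Y ({..<k} - near k) U W)"
      if p: "1 \<le> p" "p \<le> N" and k: "g \<le> k" for \<zeta> p k U W
    proof -
      let ?E = "profile ?X ?Y ({..<k} - near k) U W"
      have "\<bar>prob (visit \<zeta> p k \<inter> ?E) - prob (initial_cyl A \<zeta> p) ^ l * prob ?E\<bar>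
          \<le> ((1 + 5 * \<psi>) ^ l - 1) * (prob (initial_cyl A \<zeta> p) ^ l * prob ?E)"
        unfolding \<psi>_def
      proof (rule decouple_visit_profile[OF mix(2) _ p len(2)])
        show "enn2real (psi A P m) \<le> 1 / 4" using \<psi>_small by (simp add: \<psi>_def)
        show "g0 \<le> k" using k by (simp add: g_def)
        show "determined A (\<Union>i\<in>{1..l}. {q i j..<q i j + N}) (visit \<omega> n j)" for j
          by (rule determined_mono[OF determined_visit]) (use len in \<open>auto intro!: UN_mono\<close>)
        show "determined A (\<Union>i\<in>{1..l}. {q i j..<q i j + N}) (hazard \<eta> m j)" for j
          by (rule determined_mono[OF determined_hazard]) (use len in \<open>auto intro!: UN_mono\<close>)
      qed
      also have "\<dots> \<le> \<delta> * (prob (initial_cyl A \<zeta> p) ^ l * prob ?E)"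
        using \<delta>_power by (intro mult_right_mono) auto
      finally show ?thesis by (simp add: mult.assoc)
    qed
    have visit_le: "prob (visit \<zeta> p k) \<le> 3 / 2 * prob (initial_cyl A \<zeta> p) ^ l"
      if p: "1 \<le> p" "p \<le> N" and k: "g \<le> k" for \<zeta> p k
    proof -
      have "visit \<zeta> p k \<inter> Omega A = visit \<zeta> p k" by (auto simp: visit_def)
      moreover have "\<bar>prob (visit \<zeta> p k \<inter> Omega A) - prob (initial_cyl A \<zeta> p) ^ l * prob (Omega A)\<bar>
          \<le> ((1 + 5 * \<psi>) ^ l - 1) * (prob (initial_cyl A \<zeta> p) ^ l * prob (Omega A))"
        unfolding \<psi>_def
        by (rule decouple_visit[OF mix(2) _ p len(2), where I = "{}"])
          (use \<psi>_small k in \<open>auto simp: \<psi>_def g_def determined_def\<close>)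
      ultimately have "\<bar>prob (visit \<zeta> p k) - prob (initial_cyl A \<zeta> p) ^ l\<bar>
          \<le> ((1 + 5 * \<psi>) ^ l - 1) * prob (initial_cyl A \<zeta> p) ^ l"
        using prob_space by (simp add: space_P)
      also have "\<dots> \<le> 1 / 2 * prob (initial_cyl A \<zeta> p) ^ l"
        using \<delta>_power \<delta> by (intro mult_right_mono) auto
      finally show ?thesis by linarith
    qed
    have overlap: "prob (visit \<zeta> p k \<inter> (\<Union>j\<in>{..<k} \<inter> near k. ?X j \<union> ?Y j))
        \<le> \<theta> * prob (initial_cyl A \<zeta> p) ^ l"
      if \<zeta>: "(\<zeta>, p) \<in> {(\<omega>, n), (\<eta>, m)}" and k: "g \<le> k" for \<zeta> p k
    proof -
      have p: "1 \<le> p" "p \<le> N" using \<zeta> n m len by auto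
      let ?V = "visit \<zeta> p k" and ?J = "{..<k} \<inter> near k"
      have pair: "prob (?V \<inter> visit \<xi> r j) \<le> c * e * prob ?V"
        if "(\<xi>, r) \<in> {(\<omega>, n), (\<eta>, m)}" "j < k" for \<xi> r j
        unfolding c_def e_def
      proof (rule overlap_visit[OF mix(1) that(2) _ _ \<upsilon> decay])
        fix d y assume "1 \<le> d" "y \<in> initial_cyl A \<xi> r" "(shift ^^ d) y \<in> initial_cyl A \<zeta> p"
        then show "\<kappa> \<le> min d r"
          unfolding \<kappa>_def by (intro kappa_le_overlap[OF mem n m that(1) \<zeta>]) auto
      qed (use that mem n m in auto)
      have "prob (?V \<inter> (\<Union>j\<in>?J. ?X j \<union> ?Y j)) = prob (\<Union>j\<in>?J. ?V \<inter> ?X j \<union> ?V \<inter> ?Y j)"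
        by (intro arg_cong[where f = prob]) blast
      also have "\<dots> \<le> (\<Sum>j\<in>?J. prob (?V \<inter> ?X j \<union> ?V \<inter> ?Y j))"
        by (intro finite_measure_subadditive_finite image_subsetI sets.Un sets.Int visit_events hazard_events) simp
      also have "\<dots> \<le> (\<Sum>j\<in>?J. 2 * (c * e * prob ?V))"
      proof (rule sum_mono)
        fix j assume j: "j \<in> ?J"
        have "prob (?V \<inter> ?X j \<union> ?V \<inter> ?Y j) \<le> prob (?V \<inter> ?X j) + prob (?V \<inter> ?Y j)"
          by (intro measure_Un_le sets.Int visit_events hazard_events)
        moreover have "prob (?V \<inter> ?Y j) \<le> prob (?V \<inter> visit \<eta> m j)"
          by (intro finite_measure_mono sets.Int visit_events) (auto simp: hazard_def)
        moreover have "prob (?V \<inter> ?X j) \<le> c * e * prob ?V" "prob (?V \<inter> visit \<eta> m j) \<le> c * e * prob ?V"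
          using j by (auto intro!: pair)
        ultimately show "prob (?V \<inter> ?X j \<union> ?V \<inter> ?Y j) \<le> 2 * (c * e * prob ?V)" by linarith
      qed
      also have "\<dots> = real (card ?J) * (2 * (c * e * prob ?V))" by simp
      also have "\<dots> \<le> (real l * real l * (4 * real N)) * (2 * (c * e * (3 / 2 * prob (initial_cyl A \<zeta> p) ^ l)))"
      proof (intro mult_mono mult_left_mono visit_le[OF p k])
        have "card ?J \<le> card (near k)" by (intro card_mono near_bound) auto
        with near_bound(2)[of k] have "card ?J \<le> l * l * (4 * N)" by (rule order_trans[rotated])
        then have "real (card ?J) \<le> real (l * l * (4 * N))" by (rule of_nat_mono)
        then show "real (card ?J) \<le> real l * real l * (4 * real N)" by simp
      qed (use c in \<open>auto simp: e_def\<close>)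
      also have "\<dots> = \<theta> * prob (initial_cyl A \<zeta> p) ^ l"
        by (simp add: \<theta>_def K_def power2_eq_square)
      finally show ?thesis .
    qed
    have disj: "?X k \<inter> ?Y k = {}" for k
    proof (rule ccontr)
      assume "?X k \<inter> ?Y k \<noteq> {}"
      then obtain x where x: "x \<in> ?X k" "x \<in> visit \<eta> m k" by (auto simp: hazard_def split: if_splits)
      then have "(shift ^^ q 1 k) x \<in> initial_cyl A \<omega> n" "(shift ^^ q 1 k) x \<in> initial_cyl A \<eta> m"
        using l by (auto simp: visit_def occurs_def)
      then have "\<kappa> \<le> min 0 n"
        unfolding \<kappa>_def
        by (intro kappa_le_overlap[OF mem n m, where \<zeta>' = \<eta> and p' = m and y = "(shift ^^ q 1 k) x"]) auto
      with \<kappa> show False by simp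
    qed
    have g0_le: "real g \<le> real g0 + 1" by (simp add: g_def)
    have early: "(\<Sum>k<g. prob (?X k) + prob (?Y k)) \<le> 2 * (real g0 + 1) * s\<^sup>2"
    proof -
      have cyl_le: "prob (initial_cyl A \<zeta> p) \<le> e" if "(\<zeta>, p) \<in> {(\<omega>, n), (\<eta>, m)}" for \<zeta> p
      proof -
        have \<zeta>: "\<zeta> \<in> Omega A" "1 \<le> p" "\<kappa> \<le> p"
          using that mem n m kappa_le_length[OF mem n m] by (auto simp: \<kappa>_def)
        have "prob (initial_cyl A \<zeta> p) \<le> exp (- \<upsilon> * real p)"
          by (rule decay[OF \<zeta>(2) initial_cyl_cylinders[OF \<zeta>(1)]])
        also have "\<dots> \<le> e" unfolding e_def using \<upsilon> \<zeta>(3) by simp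
        finally show ?thesis .
      qed
      have "prob (?X k) + prob (?Y k) \<le> 2 * e" for k
      proof -
        have "prob (?Y k) \<le> prob (visit \<eta> m k)"
          by (intro finite_measure_mono visit_events) (auto simp: hazard_def)
        then show ?thesis
          using prob_visit_le[of \<omega> n k] prob_visit_le[of \<eta> m k] cyl_le[of \<omega> n] cyl_le[of \<eta> m] by simp
      qed
      then have "(\<Sum>k<g. prob (?X k) + prob (?Y k)) \<le> (\<Sum>k<g. 2 * e)" by (intro sum_mono)
      also have "\<dots> = real g * (2 * e)" by simp
      also have "\<dots> \<le> (real g0 + 1) * (2 * e)" using g0_le by (intro mult_right_mono) (auto simp: e_def)
      finally show ?thesis by (simp add: e_s algebra_simps)
    qed
    define t where "t = nat \<lceil>1 / (\<beta> * (s + w))\<rceil>"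
    have "0 \<le> L" using L by simp
    note horizon = optimal_horizon[where \<gamma> = "real g0", OF s w(1) w1 \<beta> \<alpha> len(3) K this of_nat_0_le_iff,
        folded t_def]
    have "\<bar>prob (?S -` G \<inter> space P) - measure_pmf.prob (geometric_pmf (\<beta> / (\<beta> + \<alpha>))) (enat -` G)\<bar>
      \<le> 2 / (\<beta> * real t) + 2 * \<theta> + (\<Sum>k<g. prob (?X k) + prob (?Y k)) + real t * (\<alpha> + \<beta>) * (2 * \<theta> + \<delta>)"
    proof (rule count_before_hazard_geometric[where B = near])
      show "?S x = enat (card {j \<in> {..<k}. x \<in> ?X j})"
        if "x \<in> space P" "x \<in> ?Y k" "\<And>j. j < k \<Longrightarrow> x \<notin> ?Y j" for x k
        using that by (intro Sigma_count_at_hazard) (auto simp: space_P)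
      fix k assume k: "g \<le> k"
      have Yk: "?Y k = visit \<eta> m k" using k by (auto simp: hazard_def g_def)
      show "\<bar>prob (?X k \<inter> profile ?X ?Y ({..<k} - near k) U W) - \<alpha> * prob (profile ?X ?Y ({..<k} - near k) U W)\<bar>
        \<le> \<delta> * \<alpha> * prob (profile ?X ?Y ({..<k} - near k) U W)" for U W
        unfolding \<alpha>_def by (rule dec[OF n len(1) k])
      show "\<bar>prob (?Y k \<inter> profile ?X ?Y ({..<k} - near k) U W) - \<beta> * prob (profile ?X ?Y ({..<k} - near k) U W)\<bar>
        \<le> \<delta> * \<beta> * prob (profile ?X ?Y ({..<k} - near k) U W)" for U W
        unfolding \<beta>_def Yk by (rule dec[OF m len(2) k])
      show "prob (?X k \<inter> (\<Union>j\<in>{..<k} \<inter> near k. ?X j \<union> ?Y j)) \<le> \<theta> * \<alpha>"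
        unfolding \<alpha>_def by (rule overlap[OF _ k]) simp
      show "prob (?Y k \<inter> (\<Union>j\<in>{..<k} \<inter> near k. ?X j \<union> ?Y j)) \<le> \<theta> * \<beta>"
        unfolding \<beta>_def Yk by (rule overlap[OF _ k]) simp
    qed (use visit_events hazard_events disj S_meas \<alpha> \<beta> \<delta> \<theta> horizon(1) L in auto)
    also have "\<dots> \<le> 2 / (\<beta> * real t) + 2 * \<theta> + 2 * (real g0 + 1) * s\<^sup>2 + real t * (\<alpha> + \<beta>) * (2 * \<theta> + \<delta>)"
      using early by simp
    also have "\<dots> \<le> C * R"
      using horizon(2) L unfolding C_eq R_def \<theta>_def \<delta>_def e_s w(2) by (simp only:)
    finally show ?thesis .
  qed
  have "d_TV (distr P (count_space UNIV) ?S) (Geo (\<beta> / (\<beta> + \<alpha>))) \<le> C * R"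
    unfolding d_TV_def
  proof (rule cSUP_least)
    fix G
    have "measure (distr P (count_space UNIV) ?S) G = prob (?S -` G \<inter> space P)"
      by (rule measure_distr[OF S_meas]) simp
    then show "\<bar>measure (distr P (count_space UNIV) ?S) G - measure (Geo (\<beta> / (\<beta> + \<alpha>))) G\<bar> \<le> C * R"
      using bound[of G] by (simp add: Geo_def)
  qed auto
  then show ?thesis unfolding R_def w_def \<psi>_def .
qed

end

theorem theorem2p5:
  "\<exists>C :: nat \<Rightarrow> real \<Rightarrow> real.
     (\<forall>l s. 1 \<le> C l s) \<and>
     (\<forall>(A :: 'a set) (P :: (nat \<Rightarrow> 'a) measure) (\<upsilon> :: real) (l :: nat) (q :: nat \<Rightarrow> nat \<Rightarrow> nat).
        countable A \<longrightarrow>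
        prob_space P \<longrightarrow>
        sets P = sets (seq_space A) \<longrightarrow>
        distr P P shift = P \<longrightarrow>
        psi_mixing A P \<longrightarrow>
        0 < \<upsilon> \<longrightarrow>
        (\<forall>n\<ge>1. \<forall>E\<in>cylinders A n. measure P E \<le> exp (- \<upsilon> * real n)) \<longrightarrow>
        1 \<le> l \<longrightarrow>
        (\<forall>i\<in>{1..l}. strict_mono (q i)) \<longrightarrow>
        (\<forall>n. \<forall>i\<in>{1..<l}. q i n < q (Suc i) n) \<longrightarrow>
        qgap l q \<longlonglongrightarrow> \<infinity> \<longrightarrow>
        (\<forall>\<omega>\<in>Omega_P A P. \<forall>\<eta>\<in>Omega_P A P. \<forall>n\<ge>1. \<forall>m\<ge>1.
           psi A P m < ennreal ((3 / 2) powr (1 / (real l + 1)) - 1) \<longrightarrow>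
           d_TV (distr P (count_space UNIV) (Sigma_count A l q \<omega> \<eta> n m))
             (Geo (measure P (initial_cyl A \<eta> m) ^ l
                   / (measure P (initial_cyl A \<eta> m) ^ l + measure P (initial_cyl A \<omega> n) ^ l)))
           \<le> C l (enn2real (psi A P 1)) *
              (exp (- (1 / 2) * \<upsilon> * real (kappa A \<omega> \<eta> n m)) * real (gap_index l q (max n m))
               + (1 + (measure P (initial_cyl A \<omega> n) / measure P (initial_cyl A \<eta> m)) ^ l)
                 * (real (max n m) * exp (- (1 / 2) * \<upsilon> * real (kappa A \<omega> \<eta> n m))
                    + sqrt (enn2real (psi A P m))))))"
proof (intro exI[of _ "\<lambda>l s. 6 + 96 * real l ^ 2 * (1 + \<bar>s\<bar>) + 15 * 4 ^ l"] conjI allI impI ballI)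
  fix l :: nat and s :: real
  have "0 \<le> 96 * real l ^ 2 * (1 + \<bar>s\<bar>)" "(0::real) \<le> 15 * 4 ^ l" by auto
  then show "1 \<le> 6 + 96 * real l ^ 2 * (1 + \<bar>s\<bar>) + 15 * 4 ^ l" by linarith
next
  fix A :: "'a set" and P :: "(nat \<Rightarrow> 'a) measure" and \<upsilon> :: real and l :: nat and q :: "nat \<Rightarrow> nat \<Rightarrow> nat"
    and \<omega> \<eta> :: "nat \<Rightarrow> 'a" and n m :: nat
  assume A: "countable A" and "prob_space P" and P: "sets P = sets (seq_space A)" "distr P P shift = P"
    and mix: "psi_mixing A P" and \<upsilon>: "0 < \<upsilon>"
    and decay: "\<forall>n\<ge>1. \<forall>E\<in>cylinders A n. measure P E \<le> exp (- \<upsilon> * real n)"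
    and l: "1 \<le> l" and q: "\<forall>i\<in>{1..l}. strict_mono (q i)" "\<forall>n. \<forall>i\<in>{1..<l}. q i n < q (Suc i) n"
    and lim: "qgap l q \<longlonglongrightarrow> \<infinity>"
    and \<omega>: "\<omega> \<in> Omega_P A P" and \<eta>: "\<eta> \<in> Omega_P A P" and n: "1 \<le> n" and m: "1 \<le> m"
    and psi_m: "psi A P m < ennreal ((3 / 2) powr (1 / (real l + 1)) - 1)"
  interpret prob_space P by fact
  interpret multiple_visits P A l q "max n m" "gap_index l q (max n m)"
    by unfold_locales (use A P l q gap_index_spread[OF lim q(2)] in auto)
  have fin: "psi A P 1 < \<infinity>" "psi A P m < \<infinity>"
    using mix less_trans[OF psi_m ennreal_less_top] by (auto simp: psi_mixing_def)
  show "d_TV (distr P (count_space UNIV) (Sigma_count A l q \<omega> \<eta> n m))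
        (Geo (measure P (initial_cyl A \<eta> m) ^ l
              / (measure P (initial_cyl A \<eta> m) ^ l + measure P (initial_cyl A \<omega> n) ^ l)))
      \<le> (6 + 96 * real l ^ 2 * (1 + \<bar>enn2real (psi A P 1)\<bar>) + 15 * 4 ^ l) *
         (exp (- (1 / 2) * \<upsilon> * real (kappa A \<omega> \<eta> n m)) * real (gap_index l q (max n m))
          + (1 + (measure P (initial_cyl A \<omega> n) / measure P (initial_cyl A \<eta> m)) ^ l)
            * (real (max n m) * exp (- (1 / 2) * \<upsilon> * real (kappa A \<omega> \<eta> n m))
               + sqrt (enn2real (psi A P m))))"
    unfolding power_divide abs_of_nonneg[OF enn2real_nonneg]
    by (rule visits_until_hazard_geometric[OF fin \<upsilon> _ \<omega> \<eta> n m refl]) (use decay in blast)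
qed

end
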